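(* Let $a\in L^1(0,1)$ satisfy $\int_0^1 a(x)\,dx<0$ and $a(x)>0$ on a set of positive measure. Let $f\in\mathcal C(\mathbb R)$ satisfy $f(0)=0$, $f(u)>0$ for $u>0$, and, for some constants $h>0$, $p\ge 1$ and $q\in(0,1)$, $$\lim_{u\to0^+}\frac{f(u)}{u^p}=1,\qquad \lim_{u\to\infty}\frac{f(u)}{u^{-q}}=h.$$ Then the problem $$-\left(\frac{u'}{\sqrt{1+(u')^2}}\right)'=\lambda a(x)f(u),\quad 0<x<1,\qquad u'(0)=u'(1)=0,$$ has no positive solutions (neither regular nor singular) for sufficiently small $\lambda>0$; that is, there is $\overline\lambda>0$ such that for every $\lambda\in(0,\overline\lambda)$ there is no positive bounded variation solution.
   Context: A solution is understood in the bounded variation sense: $u\in BV(0,1)$ is a bounded variation solution of the problem (for a given $\lambda$) if $$\int_0^1 \frac{Du^a\,D\phi^a}{\sqrt{1+(Du^a)^2}}\,dx+\int_0^1\frac{Du^s}{|Du^s|}\,D\phi^s=\int_0^1\lambda a f(u)\phi\,dx$$ for every $\phi\in BV(0,1)$ such that $|D\phi^s|$ is absolutely continuous with respect to $|Du^s|$. Here, for $v\in BV(0,1)$, $Dv=Dv^a\,dx+Dv^s$ is the Lebesgue decomposition of the measure $Dv$ (with $Dv^a$ the density of the absolutely continuous part and $Dv^s$ the singular part), and $\frac{Dv^s}{|Dv^s|}$ is the density of $Dv^s$ with respect to its total variation $|Dv^s|$. A regular solution is a function $u\in W^{2,1}(0,1)$ satisfying the equation a.e. in $(0,1)$ and the boundary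 conditions; every regular solution is a bounded variation solution, and a bounded variation solution which is not regular is called singular. A solution $u$ is positive if $\operatorname{ess\,inf}u\ge0$ and $\operatorname{ess\,sup}u>0$. *)

theory Defs
  imports "HOL-Analysis.Analysis" "HOL-Probability.Essential_Supremum"
begin

section \<open>Finite signed measures\<close>

text \<open>A real-valued signed measure is a set function on the sigma-algebra of a measure space;
  the measure of \<open>M\<close> itself plays no role here. Countable additivity forces
  \<open>\<nu> {} = 0\<close>, and values outside \<open>sets M\<close> are irrelevant.\<close>

definition finite_signed_measure :: "'a measure \<Rightarrow> ('a set \<Rightarrow> real) \<Rightarrow> bool" where
  "finite_signed_measure M \<nu> \<longleftrightarrow>
     (\<forall>A::nat \<Rightarrow> 'a set. range A \<subseteq> sets M \<longrightarrow> disjoint_family A \<longrightarrow>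
        (\<lambda>i. \<nu> (A i)) sums \<nu> (\<Union>i. A i))"

definition total_var :: "'a measure \<Rightarrow> ('a set \<Rightarrow> real) \<Rightarrow> 'a measure" where
  "total_var M \<nu> = measure_of (space M) (sets M)
     (\<lambda>A. SUP B \<in> {B::nat \<Rightarrow> 'a set. range B \<subseteq> sets M \<and> disjoint_family B \<and> (\<Union>i. B i) = A}.
            (\<Sum>i. ennreal \<bar>\<nu> (B i)\<bar>))"

text \<open>The density of \<open>\<nu>\<close> with respect to \<open>|\<nu>|\<close>; it is unique up to \<open>|\<nu>|\<close>-null sets, so the
  choice below does not affect integrals.\<close>

definition polar :: "'a measure \<Rightarrow> ('a set \<Rightarrow> real) \<Rightarrow> 'a \<Rightarrow> real" where
  "polar M \<nu> = (SOME \<sigma>. integrable (total_var M \<nu>) \<sigma> \<and>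
     (\<forall>A\<in>sets M. \<nu> A = (LINT x:A|total_var M \<nu>. \<sigma> x)))"

definition signed_integral :: "'a measure \<Rightarrow> ('a set \<Rightarrow> real) \<Rightarrow> ('a \<Rightarrow> real) \<Rightarrow> real" where
  "signed_integral M \<nu> g = (LINT x|total_var M \<nu>. g x * polar M \<nu> x)"

section \<open>Functions of bounded variation on (0,1)\<close>

text \<open>Elements of \<open>L\<^sup>1(0,1)\<close> are represented by functions on the real line of which only the
  values on the open interval matter.\<close>

abbreviation Leb01 :: "real measure" where
  "Leb01 \<equiv> lebesgue_on {0<..<1}"

abbreviation Bor01 :: "real measure" where
  "Bor01 \<equiv> restrict_space lborel {0<..<1}"

text \<open>The pairs of a test function \<open>\<phi>\<close> in \<open>C\<^sub>c\<^sup>1(0,1)\<close>, extended by zero, and its derivative.\<close>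

definition test_function :: "(real \<Rightarrow> real) \<Rightarrow> (real \<Rightarrow> real) \<Rightarrow> bool" where
  "test_function \<phi> \<phi>' \<longleftrightarrow>
     (\<forall>x. (\<phi> has_real_derivative \<phi>' x) (at x)) \<and> continuous_on UNIV \<phi>' \<and>
     (\<exists>K. compact K \<and> K \<subseteq> {0<..<1} \<and> (\<forall>x. x \<notin> K \<longrightarrow> \<phi> x = 0))"

text \<open>\<open>has_deriv_measure u \<nu>\<close>: \<open>u\<close> is in \<open>BV(0,1)\<close> and its distributional derivative \<open>Du\<close> is the
  finite signed Borel measure \<open>\<nu>\<close> on \<open>(0,1)\<close>.\<close>

definition has_deriv_measure :: "(real \<Rightarrow> real) \<Rightarrow> (real set \<Rightarrow> real) \<Rightarrow> bool" where
  "has_deriv_measure u \<nu> \<longleftrightarrow>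
     integrable Leb01 u \<and> finite_signed_measure Bor01 \<nu> \<and>
     (\<forall>\<phi> \<phi>'. test_function \<phi> \<phi>' \<longrightarrow>
        (LINT x|Leb01. u x * \<phi>' x) = - signed_integral Bor01 \<nu> \<phi>)"

text \<open>The Lebesgue decomposition \<open>\<nu> = g dx + \<mu>\<close>, with \<open>\<mu>\<close> concentrated on a Lebesgue-null set.\<close>

definition lebesgue_decomposition ::
    "(real set \<Rightarrow> real) \<Rightarrow> (real \<Rightarrow> real) \<Rightarrow> (real set \<Rightarrow> real) \<Rightarrow> bool" where
  "lebesgue_decomposition \<nu> g \<mu> \<longleftrightarrow>
     integrable Leb01 g \<and> finite_signed_measure Bor01 \<mu> \<and>
     (\<exists>N\<in>null_sets Bor01. emeasure (total_var Bor01 \<mu>) ({0<..<1} - N) = 0) \<and>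
     (\<forall>A\<in>sets Bor01. \<nu> A = (LINT x:A|Leb01. g x) + \<mu> A)"

text \<open>\<open>u\<close> is in \<open>BV(0,1)\<close>, with \<open>Du = ua dx + us\<close>. By uniqueness of \<open>Du\<close> and of the Lebesgue
  decomposition, \<open>ua\<close> is determined almost everywhere and \<open>us\<close> on all Borel subsets of \<open>(0,1)\<close>.\<close>

definition has_BV_derivative ::
    "(real \<Rightarrow> real) \<Rightarrow> (real \<Rightarrow> real) \<Rightarrow> (real set \<Rightarrow> real) \<Rightarrow> bool" where
  "has_BV_derivative u ua us \<longleftrightarrow>
     (\<exists>\<nu>. has_deriv_measure u \<nu> \<and> lebesgue_decomposition \<nu> ua us)"

section \<open>Bounded variation solutions\<close>

text \<open>Recall that \<open>absolutely_continuous M N\<close> means that \<open>N\<close> is absolutely continuous with respect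
  to \<open>M\<close>. The Neumann boundary conditions are encoded by the test functions \<open>\<phi>\<close> not being
  required to vanish at the end points.\<close>

definition BV_solution ::
    "(real \<Rightarrow> real) \<Rightarrow> (real \<Rightarrow> real) \<Rightarrow> real \<Rightarrow> (real \<Rightarrow> real) \<Rightarrow> bool" where
  "BV_solution a f lam u \<longleftrightarrow>
     (\<exists>ua us. has_BV_derivative u ua us \<and>
       (\<forall>\<phi> \<phi>a \<phi>s. has_BV_derivative \<phi> \<phi>a \<phi>s \<longrightarrow>
          absolutely_continuous (total_var Bor01 us) (total_var Bor01 \<phi>s) \<longrightarrow>
          (LINT x|Leb01. ua x * \<phi>a x / sqrt (1 + (ua x)\<^sup>2))
            + signed_integral Bor01 \<phi>s (polar Bor01 us)
          = (LINT x|Leb01. lam * a x * f (u x) * \<phi> x)))"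

definition essinf :: "'a measure \<Rightarrow> ('a \<Rightarrow> ereal) \<Rightarrow> ereal" where
  "essinf M g = - esssup M (\<lambda>x. - g x)"

definition positive_ess :: "(real \<Rightarrow> real) \<Rightarrow> bool" where
  "positive_ess u \<longleftrightarrow>
     essinf Leb01 (\<lambda>x. ereal (u x)) \<ge> 0 \<and> esssup Leb01 (\<lambda>x. ereal (u x)) > 0"

end

theory Submission
  imports Defs
begin

text \<open>For small \<open>\<lambda>\<close> a positive solution would be almost constant, and an almost constant \<open>u\<close> is
  incompatible with the identity \<open>\<integral> a f(u) = 0\<close>, which results from testing with a constant.

  In detail, \<open>f\<close> is bounded on the positive half-line, so the flux \<open>u'/sqrt(1 + u'\<^sup>2)\<close> is bounded by a
  multiple of \<open>\<lambda>\<close>. As the flux has modulus one on the singular part of the derivative and is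
  close to one where the derivative is large, for small \<open>\<lambda>\<close> the solution is
  Lipschitz continuous with \<open>|u'| \<le> 1\<close> and differs from a constant by at most
  \<open>2 \<lambda> A sup f(u)\<close>, where \<open>A = \<integral> |a|\<close> (\<open>BV_solution_nearly_constant\<close>). Since also \<open>f(s) \<le> K s\<close> (\<open>nonlinearity_bound\<close>), this
  difference is small relative to \<open>u\<close>: there is \<open>c > 0\<close> with \<open>|u - c| \<le> \<epsilon> c\<close>. However small or large \<open>c\<close> is,
  \<open>f(u)/f(c)\<close> is then close to one, because \<open>f\<close> behaves like a power at zero and at infinity
  (\<open>nonlinearity_slowly_varying\<close>). Dividing \<open>\<integral> a f(u) = 0\<close> by \<open>f(c)\<close> shows that \<open>\<integral> a\<close> is
  arbitrarily small, contrary to \<open>\<integral> a < 0\<close>.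

  The bounds on the derivative come from testing the equation with distribution functions
  \<open>x \<mapsto> \<mu>(0,x]\<close> of signed measures \<open>\<mu>\<close> with the singular part of \<open>Du\<close>. This needs the Hahn decomposition, which
  makes total variation and polar density accessible (\<open>polar_sign\<close>), the fact that the distribution
  function of \<open>\<mu>\<close> has derivative \<open>\<mu>\<close> (\<open>has_deriv_measure_cdf\<close>, by Fubini), and the converse that
  a function with derivative \<open>\<mu>\<close> is its distribution function up to a constant
  (\<open>has_deriv_measure_unique\<close>, from the lemma of du Bois-Reymond).\<close>

section \<open>Hahn decomposition and polar decomposition of a signed measure\<close>

lemma finite_signed_measure_sums:
  fixes A :: "nat \<Rightarrow> 'a set"
  assumes "finite_signed_measure M \<nu>" "range A \<subseteq> sets M" "disjoint_family A"
  shows "(\<lambda>i. \<nu> (A i)) sums \<nu> (\<Union>i. A i)"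
  using assms unfolding finite_signed_measure_def by blast

lemma finite_signed_measure_empty:
  assumes "finite_signed_measure M \<nu>"
  shows "\<nu> {} = 0"
proof -
  have "(\<lambda>i::nat. \<nu> {}) sums \<nu> (\<Union>i::nat. {})"
    by (rule finite_signed_measure_sums[OF assms]) (auto simp: disjoint_family_on_def)
  then have "(\<lambda>i::nat. \<nu> {}) \<longlonglongrightarrow> 0"
    by (intro summable_LIMSEQ_zero) (auto simp: sums_iff)
  then show ?thesis
    by (simp add: LIMSEQ_const_iff)
qed

lemma finite_signed_measure_Un:
  assumes \<nu>: "finite_signed_measure M \<nu>" and AB: "A \<in> sets M" "B \<in> sets M" "A \<inter> B = {}"
  shows "\<nu> (A \<union> B) = \<nu> A + \<nu> B"
proof -
  have "(\<lambda>i. \<nu> (binaryset A B i)) sums \<nu> (\<Union>i. binaryset A B i)"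
    by (rule finite_signed_measure_sums[OF \<nu>])
      (use AB in \<open>auto simp: disjoint_family_on_def binaryset_def\<close>)
  moreover have "(\<lambda>i. \<nu> (binaryset A B i)) sums (\<nu> A + \<nu> B)"
    by (rule binaryset_sums) (rule finite_signed_measure_empty[OF \<nu>])
  ultimately show ?thesis
    by (simp add: UN_binaryset_eq sums_iff)
qed

lemma finite_signed_measure_split:
  assumes "finite_signed_measure M \<nu>" "A \<in> sets M" "B \<in> sets M"
  shows "\<nu> A = \<nu> (A \<inter> B) + \<nu> (A - B)"
  using finite_signed_measure_Un[OF assms(1), of "A \<inter> B" "A - B"] assms(2,3)
  by (auto simp: Int_Diff_Un)

definition positive_on :: "'a measure \<Rightarrow> ('a set \<Rightarrow> real) \<Rightarrow> 'a set \<Rightarrow> bool" where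
  "positive_on M \<nu> P \<longleftrightarrow> P \<in> sets M \<and> (\<forall>A\<in>sets M. A \<subseteq> P \<longrightarrow> 0 \<le> \<nu> A)"

text \<open>One keeps removing from \<open>A\<close> a subset whose measure is, up to the scale \<open>1/n\<close>, as negative as
  possible. The removed pieces are disjoint, so their measures tend to zero, and a subset
  of negative measure in what is left would have been removed earlier.\<close>

lemma positive_subset_exists:
  assumes \<nu>: "finite_signed_measure M \<nu>" and A: "A \<in> sets M"
  shows "\<exists>P. positive_on M \<nu> P \<and> P \<subseteq> A \<and> \<nu> A \<le> \<nu> P"
proof -
  (* C is a good piece to remove from B if it lies below -1/(N+1) whenever some subset of B does *)
  define good where "good B C \<longleftrightarrow> C \<in> sets M \<and> C \<subseteq> B \<and> \<nu> C \<le> 0 \<and>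
    (\<forall>N::nat. (\<exists>D\<in>sets M. D \<subseteq> B \<and> \<nu> D < - inverse (real (Suc N))) \<longrightarrow>
       \<nu> C < - inverse (real (Suc N)))" for B C
  have "\<exists>C. good B C" for B
  proof (cases "\<exists>N::nat. \<exists>D\<in>sets M. D \<subseteq> B \<and> \<nu> D < - inverse (real (Suc N))")
    case True
    let ?Q = "\<lambda>N::nat. \<exists>D\<in>sets M. D \<subseteq> B \<and> \<nu> D < - inverse (real (Suc N))"
    obtain C where C: "C \<in> sets M" "C \<subseteq> B" "\<nu> C < - inverse (real (Suc (LEAST N. ?Q N)))"
      using LeastI_ex[OF True] by blast
    have "\<nu> C < - inverse (real (Suc N))" if "?Q N" for N
    proof -
      have "inverse (real (Suc N)) \<le> inverse (real (Suc (LEAST N. ?Q N)))"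
        using Least_le[of ?Q, OF that] by (intro le_imp_inverse_le) auto
      then show ?thesis using C(3) by linarith
    qed
    moreover have "\<nu> C \<le> 0"
      using C(3) by (smt (verit) inverse_nonnegative_iff_nonnegative of_nat_0_le_iff)
    ultimately have "good B C"
      using C unfolding good_def by blast
    then show ?thesis ..
  next
    case False
    then have "good B {}"
      unfolding good_def using finite_signed_measure_empty[OF \<nu>] by auto
    then show ?thesis ..
  qed
  then obtain c where c: "\<And>B. good B (c B)" by metis
  define B where "B = rec_nat A (\<lambda>_ S. S - c S)"
  have B0: "B 0 = A" and BS: "\<And>n. B (Suc n) = B n - c (B n)"
    by (simp_all add: B_def)
  have c_sets: "c S \<in> sets M" "c S \<subseteq> S" "\<nu> (c S) \<le> 0" for S
    using c[of S] by (auto simp: good_def)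
  have B_sets: "B n \<in> sets M" for n
    by (induction n) (auto simp: B0 BS A c_sets)
  have B_anti: "B n \<subseteq> B m" if "m \<le> n" for m n
    using that by (induction n rule: dec_induct) (auto simp: BS)
  define C where "C n = c (B n)" for n
  have C_out: "C m \<inter> B n = {}" if "m < n" for m n
    using B_anti[of "Suc m" n] that by (auto simp: C_def BS)
  have disj: "disjoint_family C"
    unfolding disjoint_family_on_def
  proof (intro ballI impI)
    fix m n :: nat assume "m \<noteq> n"
    then show "C m \<inter> C n = {}"
    proof (cases "m < n")
      case True
      then show ?thesis
        using C_out[of m n] c_sets(2)[of "B n"] unfolding C_def by blast
    next
      case False
      then have "n < m" using \<open>m \<noteq> n\<close> by simp
      then show ?thesis
        using C_out[of n m] c_sets(2)[of "B m"] unfolding C_def by blast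
    qed
  qed
  have C_sets: "range C \<subseteq> sets M" by (auto simp: C_def c_sets)
  have C_sums: "(\<lambda>n. \<nu> (C n)) sums \<nu> (\<Union>n. C n)"
    by (rule finite_signed_measure_sums[OF \<nu> C_sets disj])
  define P where "P = A - (\<Union>n. C n)"
  have UC: "(\<Union>n. C n) \<in> sets M" using C_sets by auto
  have P_sets: "P \<in> sets M" unfolding P_def using A UC by auto
  have CA: "(\<Union>n. C n) \<subseteq> A"
    using c_sets(2) B_anti[of 0] unfolding C_def B0 by blast
  have P_B: "P \<subseteq> B n" for n
  proof (induction n)
    case (Suc n) then show ?case by (auto simp: BS P_def C_def)
  qed (auto simp: B0 P_def)
  have "\<nu> A = \<nu> (A \<inter> (\<Union>n. C n)) + \<nu> P"
    unfolding P_def by (rule finite_signed_measure_split[OF \<nu> A UC])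
  moreover have "\<nu> (\<Union>n. C n) \<le> 0"
    by (rule sums_le[OF _ C_sums sums_zero]) (simp add: C_def c_sets)
  ultimately have 1: "\<nu> A \<le> \<nu> P" using CA by (simp add: inf_absorb2)
  have "0 \<le> \<nu> D" if D: "D \<in> sets M" "D \<subseteq> P" for D
  proof (rule ccontr)
    assume "\<not> 0 \<le> \<nu> D"
    then obtain N where N: "inverse (real (Suc N)) < - \<nu> D"
      using reals_Archimedean[of "- \<nu> D"] by (meson neg_0_less_iff_less not_le)
    have "\<nu> (C n) \<le> - inverse (real (Suc N))" for n
    proof -
      have "\<exists>D\<in>sets M. D \<subseteq> B n \<and> \<nu> D < - inverse (real (Suc N))"
        using D N P_B[of n] by (intro bexI[of _ D]) auto
      then have "\<nu> (C n) < - inverse (real (Suc N))"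
        using c[of "B n"] unfolding good_def C_def by blast
      then show ?thesis by simp
    qed
    moreover have "(\<lambda>n. \<nu> (C n)) \<longlonglongrightarrow> 0"
      using C_sums by (intro summable_LIMSEQ_zero) (auto simp: sums_iff)
    ultimately have "0 \<le> - inverse (real (Suc N))"
      by (intro LIMSEQ_le_const2) auto
    then show False by simp
  qed
  then show ?thesis
    using 1 P_sets by (intro exI[of _ P]) (auto simp: positive_on_def P_def)
qed

lemma positive_on_UN:
  fixes P :: "nat \<Rightarrow> 'a set"
  assumes \<nu>: "finite_signed_measure M \<nu>" and P: "\<And>n. positive_on M \<nu> (P n)"
  shows "positive_on M \<nu> (\<Union>n. P n)"
  unfolding positive_on_def
proof (intro conjI ballI impI)
  show "(\<Union>n. P n) \<in> sets M" using P by (auto simp: positive_on_def)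
  fix A assume A: "A \<in> sets M" "A \<subseteq> (\<Union>n. P n)"
  have sets: "P n \<in> sets M" for n using P by (auto simp: positive_on_def)
  have disj_sets: "disjointed P n \<in> sets M" for n
    using sets by (simp add: disjointed_def)
  have "(\<lambda>n. \<nu> (A \<inter> disjointed P n)) sums \<nu> (\<Union>n. A \<inter> disjointed P n)"
  proof (rule finite_signed_measure_sums[OF \<nu>])
    show "range (\<lambda>n. A \<inter> disjointed P n) \<subseteq> sets M"
      using disj_sets A by auto
    show "disjoint_family (\<lambda>n. A \<inter> disjointed P n)"
      using disjoint_family_disjointed[of P] by (auto simp: disjoint_family_on_def)
  qed
  moreover have "(\<Union>n. A \<inter> disjointed P n) = A"
    using A(2) UN_disjointed_eq[of P] by blast
  moreover have "0 \<le> \<nu> (A \<inter> disjointed P n)" for n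
    using P[of n] disj_sets[of n] A(1) disjointed_subset[of P n]
    unfolding positive_on_def by (meson inf.coboundedI2 sets.Int)
  ultimately show "0 \<le> \<nu> A"
    using sums_le[OF _ sums_zero, of "\<lambda>n. \<nu> (A \<inter> disjointed P n)"] by simp
qed

lemma positive_on_mono:
  assumes "finite_signed_measure M \<nu>" "positive_on M \<nu> P" "Q \<in> sets M" "Q \<subseteq> P"
  shows "\<nu> Q \<le> \<nu> P"
proof -
  have "P \<in> sets M" "0 \<le> \<nu> (P - Q)"
    using assms(2-) unfolding positive_on_def by auto
  then show ?thesis
    using finite_signed_measure_split[OF assms(1), of P Q] assms(3,4) by (simp add: inf_absorb2)
qed

text \<open>By countable unions the supremum of the measures of positive sets is attained by some
  positive \<open>P\<close>, and so is finite. A set of positive measure outside \<open>P\<close> would contain a positive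
  set whose union with \<open>P\<close> exceeds that supremum.\<close>

lemma Hahn_decomposition:
  assumes \<nu>: "finite_signed_measure M \<nu>"
  shows "\<exists>P\<in>sets M. (\<forall>A\<in>sets M. A \<subseteq> P \<longrightarrow> 0 \<le> \<nu> A) \<and> (\<forall>A\<in>sets M. A \<inter> P = {} \<longrightarrow> \<nu> A \<le> 0)"
proof -
  have emp: "positive_on M \<nu> {}"
    using finite_signed_measure_empty[OF \<nu>] by (auto simp: positive_on_def)
  have "\<exists>P. positive_on M \<nu> P \<and> (\<forall>Q. positive_on M \<nu> Q \<longrightarrow> \<nu> Q \<le> \<nu> P)"
  proof -
    define s where "s = (SUP Q\<in>{Q. positive_on M \<nu> Q}. ereal (\<nu> Q))"
    have ne: "(\<lambda>Q. ereal (\<nu> Q)) ` {Q. positive_on M \<nu> Q} \<noteq> {}" using emp by auto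
    obtain y where y: "\<And>n::nat. y n \<in> (\<lambda>Q. ereal (\<nu> Q)) ` {Q. positive_on M \<nu> Q}" "y \<longlonglongrightarrow> s"
      using Sup_countable_SUP[OF ne] unfolding s_def
      by (metis (no_types, lifting) LIMSEQ_SUP range_subsetD)
    have "\<forall>n. \<exists>Q. positive_on M \<nu> Q \<and> y n = ereal (\<nu> Q)" using y(1) by blast
    then obtain P where P: "\<And>n. positive_on M \<nu> (P n)" "\<And>n. y n = ereal (\<nu> (P n))" by metis
    have U: "positive_on M \<nu> (\<Union>n. P n)" by (rule positive_on_UN[OF \<nu> P(1)])
    have "y n \<le> ereal (\<nu> (\<Union>n. P n))" for n
      using positive_on_mono[OF \<nu> U, of "P n"] P by (auto simp: positive_on_def)
    then have "s \<le> ereal (\<nu> (\<Union>n. P n))"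
      by (intro LIMSEQ_le_const2[OF y(2)]) auto
    moreover have "ereal (\<nu> Q) \<le> s" if "positive_on M \<nu> Q" for Q
      unfolding s_def by (rule SUP_upper) (use that in auto)
    ultimately show ?thesis using U
      by (metis ereal_less_eq(3) order_trans)
  qed
  then obtain P where P: "positive_on M \<nu> P" and max: "\<And>Q. positive_on M \<nu> Q \<Longrightarrow> \<nu> Q \<le> \<nu> P"
    by blast
  have "\<nu> A \<le> 0" if A: "A \<in> sets M" "A \<inter> P = {}" for A
  proof (rule ccontr)
    assume neg: "\<not> \<nu> A \<le> 0"
    obtain R where R: "positive_on M \<nu> R" "R \<subseteq> A" "\<nu> A \<le> \<nu> R"
      using positive_subset_exists[OF \<nu> A(1)] by blast
    have "positive_on M \<nu> (\<Union>n. binaryset P R n)"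
      by (rule positive_on_UN[OF \<nu>]) (use P R(1) emp in \<open>auto simp: binaryset_def\<close>)
    then have "positive_on M \<nu> (P \<union> R)" by (simp add: UN_binaryset_eq)
    then have "\<nu> (P \<union> R) \<le> \<nu> P" by (rule max)
    moreover have "\<nu> (P \<union> R) = \<nu> P + \<nu> R"
      by (rule finite_signed_measure_Un[OF \<nu>]) (use P R A(2) in \<open>auto simp: positive_on_def\<close>)
    ultimately show False using R(3) neg by linarith
  qed
  then show ?thesis using P by (auto simp: positive_on_def)
qed

lemma space_total_var [simp]: "space (total_var M \<nu>) = space M"
  unfolding total_var_def by (simp add: space_measure_of_conv)

lemma sets_total_var [simp, measurable_cong]: "sets (total_var M \<nu>) = sets M"
  unfolding total_var_def by (simp add: sets.sets_measure_of_eq)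

text \<open>On a Hahn decomposition the total variation is explicit: the supremum over partitions is
  attained by splitting \<open>A\<close> along \<open>P\<close>. This also shows that it is finite and countably additive,
  without which the measure built from this set function would not take its values.\<close>

lemma emeasure_total_var:
  assumes \<nu>: "finite_signed_measure M \<nu>" and P: "P \<in> sets M"
    and pos: "\<And>A. A \<in> sets M \<Longrightarrow> A \<subseteq> P \<Longrightarrow> 0 \<le> \<nu> A"
    and neg: "\<And>A. A \<in> sets M \<Longrightarrow> A \<inter> P = {} \<Longrightarrow> \<nu> A \<le> 0"
    and A: "A \<in> sets M"
  shows "emeasure (total_var M \<nu>) A = ennreal (\<nu> (A \<inter> P) - \<nu> (A - P))"
proof -
  define \<tau> where "\<tau> A = \<nu> (A \<inter> P) - \<nu> (A - P)" for A
  have nn: "0 \<le> \<nu> (A \<inter> P)" "\<nu> (A - P) \<le> 0" if "A \<in> sets M" for A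
    using pos[of "A \<inter> P"] neg[of "A - P"] that P by auto
  have \<tau>_nn: "0 \<le> \<tau> A" if "A \<in> sets M" for A
    using nn[OF that] by (simp add: \<tau>_def)
  have abs_le: "\<bar>\<nu> A\<bar> \<le> \<tau> A" if "A \<in> sets M" for A
    using nn[OF that] finite_signed_measure_split[OF \<nu> that P] by (simp add: \<tau>_def)
  have \<tau>_sums: "(\<lambda>i. \<tau> (B i)) sums \<tau> (\<Union>i. B i)"
    if B: "range B \<subseteq> sets M" "disjoint_family B" for B :: "nat \<Rightarrow> 'a set"
  proof -
    have "(\<lambda>i. \<nu> (B i \<inter> P)) sums \<nu> (\<Union>i. B i \<inter> P)"
      by (rule finite_signed_measure_sums[OF \<nu>])
        (use B P in \<open>auto simp: disjoint_family_on_def\<close>)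
    moreover have "(\<lambda>i. \<nu> (B i - P)) sums \<nu> (\<Union>i. B i - P)"
      by (rule finite_signed_measure_sums[OF \<nu>])
        (use B P in \<open>auto simp: disjoint_family_on_def\<close>)
    ultimately have "(\<lambda>i. \<nu> (B i \<inter> P) - \<nu> (B i - P)) sums (\<nu> (\<Union>i. B i \<inter> P) - \<nu> (\<Union>i. B i - P))"
      by (rule sums_diff)
    then show ?thesis by (simp add: \<tau>_def)
  qed
  have suminf_\<tau>: "(\<Sum>i. ennreal (\<tau> (B i))) = ennreal (\<tau> (\<Union>i. B i))"
    if B: "range B \<subseteq> sets M" "disjoint_family B" for B :: "nat \<Rightarrow> 'a set"
    using \<tau>_sums[OF B] B(1) by (intro suminf_ennreal_eq \<tau>_nn) auto
  let ?S = "\<lambda>A. SUP B \<in> {B::nat \<Rightarrow> 'a set. range B \<subseteq> sets M \<and> disjoint_family B \<and> (\<Union>i. B i) = A}.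
            (\<Sum>i. ennreal \<bar>\<nu> (B i)\<bar>)"
  have S: "?S A = ennreal (\<tau> A)" if A: "A \<in> sets M" for A
  proof (rule antisym)
    show "?S A \<le> ennreal (\<tau> A)"
    proof (rule SUP_least, clarsimp)
      fix B :: "nat \<Rightarrow> 'a set" assume B: "range B \<subseteq> sets M" "disjoint_family B" "A = (\<Union>i. B i)"
      have "(\<Sum>i. ennreal \<bar>\<nu> (B i)\<bar>) \<le> (\<Sum>i. ennreal (\<tau> (B i)))"
        using B(1) by (intro suminf_le ennreal_leI abs_le) auto
      then show "(\<Sum>i. ennreal \<bar>\<nu> (B i)\<bar>) \<le> ennreal (\<tau> (\<Union>i. B i))"
        using suminf_\<tau>[OF B(1,2)] by simp
    qed
    let ?B = "binaryset (A \<inter> P) (A - P)"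
    have "(\<lambda>i. \<bar>\<nu> (?B i)\<bar>) sums (\<bar>\<nu> (A \<inter> P)\<bar> + \<bar>\<nu> (A - P)\<bar>)"
      by (rule binaryset_sums[of "\<lambda>X. \<bar>\<nu> X\<bar>"]) (simp add: finite_signed_measure_empty[OF \<nu>])
    then have "(\<Sum>i. ennreal \<bar>\<nu> (?B i)\<bar>) = ennreal (\<tau> A)"
      using nn[OF A] by (subst suminf_ennreal_eq) (auto simp: \<tau>_def)
    moreover have "(\<Sum>i. ennreal \<bar>\<nu> (?B i)\<bar>) \<le> ?S A"
    proof (rule SUP_upper, simp, intro conjI)
      show "range ?B \<subseteq> sets M" "disjoint_family ?B"
        using A P by (auto simp: disjoint_family_on_def binaryset_def)
      show "(\<Union>i. ?B i) = A" by (auto simp: UN_binaryset_eq)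
    qed
    ultimately show "ennreal (\<tau> A) \<le> ?S A" by simp
  qed
  have eq: "total_var M \<nu> = measure_of (space M) (sets M) (\<lambda>A. ennreal (\<tau> A))"
    unfolding total_var_def
    by (rule measure_of_eq[OF sets.space_closed]) (simp add: S sets.sigma_sets_eq)
  have "emeasure (total_var M \<nu>) A = ennreal (\<tau> A)"
  proof (rule emeasure_measure_of[OF eq sets.space_closed])
    show "A \<in> sets (total_var M \<nu>)" using A by simp
    show "positive (sets (total_var M \<nu>)) (\<lambda>A. ennreal (\<tau> A))"
      by (simp add: positive_def \<tau>_def)
    show "countably_additive (sets (total_var M \<nu>)) (\<lambda>A. ennreal (\<tau> A))"
      unfolding countably_additive_def using suminf_\<tau> by simp
  qed
  then show ?thesis by (simp add: \<tau>_def)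
qed

text \<open>The function \<open>\<plusminus>1\<close> of a Hahn decomposition is a density of \<open>\<nu>\<close> with respect to \<open>|\<nu>|\<close>, so such
  densities exist and the one picked by \<open>polar\<close> agrees with it almost everywhere. The
  representative \<open>\<sigma>\<close> has modulus one everywhere, which gives pointwise bounds on product spaces.\<close>

lemma polar_sign:
  assumes \<nu>: "finite_signed_measure M \<nu>"
  obtains \<sigma> where "finite_measure (total_var M \<nu>)"
    "\<sigma> \<in> borel_measurable M" "\<And>x. \<bar>\<sigma> x\<bar> = 1"
    "AE x in total_var M \<nu>. polar M \<nu> x = \<sigma> x" "polar M \<nu> \<in> borel_measurable M"
    "\<And>A. A \<in> sets M \<Longrightarrow> \<nu> A = (LINT x:A|total_var M \<nu>. \<sigma> x)"
proof -
  obtain P where P: "P \<in> sets M" and "\<forall>A\<in>sets M. A \<subseteq> P \<longrightarrow> 0 \<le> \<nu> A"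
    and "\<forall>A\<in>sets M. A \<inter> P = {} \<longrightarrow> \<nu> A \<le> 0"
    using Hahn_decomposition[OF \<nu>] by (elim bexE conjE)
  then have pos: "\<And>A. A \<in> sets M \<Longrightarrow> A \<subseteq> P \<Longrightarrow> 0 \<le> \<nu> A"
    and neg: "\<And>A. A \<in> sets M \<Longrightarrow> A \<inter> P = {} \<Longrightarrow> \<nu> A \<le> 0"
    by simp_all
  let ?T = "total_var M \<nu>"
  have em: "emeasure ?T A = ennreal (\<nu> (A \<inter> P) - \<nu> (A - P))" if "A \<in> sets M" for A
    by (rule emeasure_total_var[OF \<nu> P _ _ that]) (fact pos, fact neg)
  interpret T: finite_measure ?T
    by (rule finite_measureI) (simp add: em)
  define \<sigma> :: "'a \<Rightarrow> real" where "\<sigma> x = indicator P x - indicator (- P) x" for x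
  have \<sigma>1: "\<bar>\<sigma> x\<bar> = 1" for x by (auto simp: \<sigma>_def indicator_def)
  have \<sigma>m[measurable]: "\<sigma> \<in> borel_measurable M"
  proof -
    have "\<sigma> = (\<lambda>x. 2 * indicator P x - 1)" by (auto simp: \<sigma>_def indicator_def fun_eq_iff)
    then show ?thesis using P by simp
  qed
  have int: "integrable ?T \<sigma>"
    by (rule T.integrable_const_bound[of _ 1]) (auto simp: \<sigma>1)
  have rep: "\<nu> A = (LINT x:A|?T. \<sigma> x)" if A: "A \<in> sets M" for A
  proof -
    have "\<nu> (A \<inter> P) \<ge> 0" "\<nu> (A - P) \<le> 0" using pos[of "A \<inter> P"] neg[of "A - P"] A P by auto
    then have m: "measure ?T (A \<inter> P) = \<nu> (A \<inter> P)" "measure ?T (A - P) = - \<nu> (A - P)"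
    proof -
      have e: "A \<inter> P - P = {}" "(A - P) \<inter> P = {}" "A \<inter> P \<inter> P = A \<inter> P" "A - P - P = A - P"
        by auto
      have "A \<inter> P \<in> sets M" "A - P \<in> sets M" using A P by auto
      note this[THEN em, unfolded e finite_signed_measure_empty[OF \<nu>]]
      then show "measure ?T (A \<inter> P) = \<nu> (A \<inter> P)" "measure ?T (A - P) = - \<nu> (A - P)"
        using \<open>\<nu> (A \<inter> P) \<ge> 0\<close> \<open>\<nu> (A - P) \<le> 0\<close> by (simp_all add: measure_def)
    qed
    have "(LINT x:A|?T. \<sigma> x) = (LINT x|?T. indicator (A \<inter> P) x - indicator (A - P) x)"
      unfolding set_lebesgue_integral_def
      by (intro Bochner_Integration.integral_cong) (auto simp: \<sigma>_def indicator_def)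
    also have "\<dots> = measure ?T (A \<inter> P) - measure ?T (A - P)"
      using A P sets.sets_into_space[OF A]
      by (subst Bochner_Integration.integral_diff) (auto simp: T.emeasure_eq_measure Int_absorb2)
    finally show ?thesis
      using m finite_signed_measure_split[OF \<nu> A P] by simp
  qed
  have polar: "integrable ?T (polar M \<nu>) \<and> (\<forall>A\<in>sets M. \<nu> A = (LINT x:A|?T. polar M \<nu> x))"
    unfolding polar_def by (rule someI[of _ \<sigma>]) (use int rep in auto)
  have "AE x in ?T. polar M \<nu> x = \<sigma> x"
    by (rule density_unique_real) (use polar int rep in auto)
  moreover have "polar M \<nu> \<in> borel_measurable M"
    using polar borel_measurable_integrable[of ?T "polar M \<nu>"]
    by (simp cong: measurable_cong_sets)
  ultimately show thesis
    by (intro that[of \<sigma>] T.finite_measure_axioms \<sigma>m \<sigma>1 rep)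
qed

lemma signed_integral_sign:
  assumes "finite_signed_measure M \<nu>" 
  obtains \<sigma> where "finite_measure (total_var M \<nu>)"
    "\<sigma> \<in> borel_measurable M" "\<And>x. \<bar>\<sigma> x\<bar> = 1"
    "\<And>A. A \<in> sets M \<Longrightarrow> \<nu> A = (LINT x:A|total_var M \<nu>. \<sigma> x)"
    "\<And>g. g \<in> borel_measurable M \<Longrightarrow> signed_integral M \<nu> g = (LINT x|total_var M \<nu>. g x * \<sigma> x)"
proof -
  obtain \<sigma> where \<sigma>: "finite_measure (total_var M \<nu>)"
    "\<sigma> \<in> borel_measurable M" "\<And>x. \<bar>\<sigma> x\<bar> = 1"
    "AE x in total_var M \<nu>. polar M \<nu> x = \<sigma> x" "polar M \<nu> \<in> borel_measurable M"
    "\<And>A. A \<in> sets M \<Longrightarrow> \<nu> A = (LINT x:A|total_var M \<nu>. \<sigma> x)"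
    by (rule polar_sign[OF assms]) (rule that)
  note [measurable] = \<sigma>(2,5)
  have "signed_integral M \<nu> g = (LINT x|total_var M \<nu>. g x * \<sigma> x)" 
    if [measurable]: "g \<in> borel_measurable M" for g
    unfolding signed_integral_def using \<sigma>(4) by (intro integral_cong_AE) auto
  then show thesis by (intro that[of \<sigma>] \<sigma>)
qed

text \<open>Pairing the polar density with its own measure integrates \<open>\<sigma>\<^sup>2 = 1\<close>: this is how testing the
  equation detects the full mass of the singular part.\<close>

lemma signed_integral_polar_self:
  assumes "finite_signed_measure M \<nu>"
  shows "signed_integral M \<nu> (polar M \<nu>) = measure (total_var M \<nu>) (space M)"
proof -
  obtain \<sigma> where \<sigma>: "finite_measure (total_var M \<nu>)"
    "\<sigma> \<in> borel_measurable M" "\<And>x. \<bar>\<sigma> x\<bar> = 1"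
    "AE x in total_var M \<nu>. polar M \<nu> x = \<sigma> x" "polar M \<nu> \<in> borel_measurable M"
    "\<And>A. A \<in> sets M \<Longrightarrow> \<nu> A = (LINT x:A|total_var M \<nu>. \<sigma> x)"
    by (rule polar_sign[OF assms]) (rule that)
  note [measurable] = \<sigma>(2,5)
  have sq: "\<sigma> x * \<sigma> x = 1" for x
    using \<sigma>(3)[of x] by (metis abs_mult_self_eq mult_1)
  have "signed_integral M \<nu> (polar M \<nu>) = (LINT x|total_var M \<nu>. 1)"
    unfolding signed_integral_def
    by (intro integral_cong_AE) (use \<sigma>(4) sq in \<open>auto elim!: AE_mp\<close>)
  then show ?thesis by simp
qed

lemma abs_finite_signed_measure_le:
  assumes \<nu>: "finite_signed_measure M \<nu>" and A: "A \<in> sets M"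
  shows "\<bar>\<nu> A\<bar> \<le> measure (total_var M \<nu>) (space M)"
proof -
  obtain \<sigma> where \<sigma>: "finite_measure (total_var M \<nu>)"
    "\<sigma> \<in> borel_measurable M" "\<And>x. \<bar>\<sigma> x\<bar> = 1"
    "\<And>A. A \<in> sets M \<Longrightarrow> \<nu> A = (LINT x:A|total_var M \<nu>. \<sigma> x)"
    by (rule polar_sign[OF \<nu>]) (rule that)
  interpret finite_measure "total_var M \<nu>" by fact
  note [measurable] = \<sigma>(2)
  have "\<bar>\<nu> A\<bar> \<le> (LINT x|total_var M \<nu>. \<bar>indicator A x *\<^sub>R \<sigma> x\<bar>)"
    unfolding \<sigma>(4)[OF A] set_lebesgue_integral_def by (rule integral_abs_bound)
  also have "\<dots> \<le> (LINT x|total_var M \<nu>. 1)"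
  proof (rule integral_mono)
    show "integrable (total_var M \<nu>) (\<lambda>x. \<bar>indicat_real A x *\<^sub>R \<sigma> x\<bar>)"
      by (rule integrable_const_bound[of _ 1]) (use A in \<open>auto simp: \<sigma>(3) indicator_def\<close>)
  qed (auto simp: \<sigma>(3) indicator_def)
  finally show ?thesis by simp
qed

lemma finite_signed_measure_add:
  assumes "finite_signed_measure M \<mu>" "finite_signed_measure M \<nu>"
  shows "finite_signed_measure M (\<lambda>A. \<mu> A + \<nu> A)"
  using assms unfolding finite_signed_measure_def by (auto intro!: sums_add)

section \<open>Functions with a prescribed derivative measure\<close>

lemma borel_measurable_Bor01_iff:
  fixes g :: "real \<Rightarrow> real"
  shows "g \<in> borel_measurable Bor01 \<longleftrightarrow> (\<lambda>x. indicator {0<..<1} x *\<^sub>R g x) \<in> borel_measurable lborel"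
  by (subst borel_measurable_restrict_space_iff) (auto simp: mult.commute)

lemma integrable_Leb01_iff_Bor01:
  fixes g :: "real \<Rightarrow> real"
  assumes "g \<in> borel_measurable Bor01"
  shows "integrable Leb01 g \<longleftrightarrow> integrable Bor01 g"
  using assms by (simp add: integrable_restrict_space integrable_completion borel_measurable_Bor01_iff)

lemma integral_Leb01_eq_Bor01:
  fixes g :: "real \<Rightarrow> real"
  assumes "g \<in> borel_measurable Bor01"
  shows "(LINT x|Leb01. g x) = (LINT x|Bor01. g x)"
  using assms by (simp add: integral_restrict_space integral_completion borel_measurable_Bor01_iff)

lemma space_Bor01: "space Bor01 = {0<..<1}"
  by (simp add: space_restrict_space)

lemma sets_Bor01_I: "A \<in> sets borel \<Longrightarrow> A \<subseteq> {0<..<1} \<Longrightarrow> A \<in> sets Bor01"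
  by (subst sets_restrict_space_iff) auto

lemma sets_Bor01_imp_Leb01: "A \<in> sets Bor01 \<Longrightarrow> A \<in> sets Leb01"
  by (auto simp: sets_restrict_space_iff intro: sets_completionI_sets)

lemma finite_measure_Bor01: "finite_measure Bor01"
  by (rule finite_measureI) (simp add: emeasure_restrict_space)

lemma test_functionD:
  assumes "test_function \<phi> \<phi>'"
  shows "\<And>x. (\<phi> has_real_derivative \<phi>' x) (at x)" "continuous_on A \<phi>'" "continuous_on A \<phi>"
    "\<phi> 0 = 0" "\<phi> 1 = 0"
proof -
  show d: "\<And>x. (\<phi> has_real_derivative \<phi>' x) (at x)" and "continuous_on A \<phi>'"
    using assms continuous_on_subset[of UNIV \<phi>' A] by (auto simp: test_function_def)
  show "continuous_on A \<phi>"
    using d by (meson DERIV_isCont continuous_at_imp_continuous_on)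
  obtain K where K: "K \<subseteq> {0<..<1}" "\<And>x. x \<notin> K \<Longrightarrow> \<phi> x = 0"
    using assms by (auto simp: test_function_def)
  have "0 \<notin> K" "1 \<notin> K" using K(1) by auto
  then show "\<phi> 0 = 0" "\<phi> 1 = 0" using K(2) by auto
qed

lemma test_function_bounded:
  assumes "test_function \<phi> \<phi>'"
  shows "\<exists>B. \<forall>x\<in>{0..1}. \<bar>\<phi>' x\<bar> \<le> B"
proof -
  have "compact (\<phi>' ` {0..1})"
    by (intro compact_continuous_image test_functionD(2)[OF assms]) simp
  from compact_imp_bounded[OF this] show ?thesis
    by (auto simp: bounded_iff)
qed

lemma borel_measurable_Bor01_continuous:
  fixes g :: "real \<Rightarrow> real"
  shows "continuous_on UNIV g \<Longrightarrow> g \<in> borel_measurable Bor01"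
  by (rule measurable_restrict_space1) (simp add: borel_measurable_continuous_onI)

lemma integral_test_function_tail:
  assumes "test_function \<phi> \<phi>'" and y: "0 \<le> y" "y \<le> 1"
  shows "(LINT x|Bor01. (if y \<le> x then \<phi>' x else 0)) = - \<phi> y"
proof -
  note \<phi> = test_functionD[OF assms(1)]
  have "(LINT x|Bor01. (if y \<le> x then \<phi>' x else 0))
      = (LINT x|lborel. indicator {0<..<1} x *\<^sub>R (if y \<le> x then \<phi>' x else 0))"
    by (rule integral_restrict_space) simp
  also have "\<dots> = (LINT x|lborel. indicator {y..1} x *\<^sub>R \<phi>' x)"
  proof (rule integral_cong_AE)
    have [measurable]: "\<phi>' \<in> borel_measurable borel"
      by (rule borel_measurable_continuous_onI[OF \<phi>(2)])
    show "(\<lambda>x. indicator {0<..<1} x *\<^sub>R (if y \<le> x then \<phi>' x else 0)) \<in> borel_measurable lborel"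
      "(\<lambda>x. indicator {y..1} x *\<^sub>R \<phi>' x) \<in> borel_measurable lborel"
      by measurable
    show "AE x in lborel. indicator {0<..<1} x *\<^sub>R (if y \<le> x then \<phi>' x else 0)
        = indicator {y..1} x *\<^sub>R \<phi>' x"
      using AE_lborel_singleton[of 0] AE_lborel_singleton[of 1]
      by eventually_elim (use y in \<open>auto simp: indicator_def\<close>)
  qed
  also have "\<dots> = \<phi> 1 - \<phi> y"
    using \<phi>(1)
    by (intro integral_FTC_atLeastAtMost \<phi>(2) y(2))
      (auto simp flip: has_real_derivative_iff_has_vector_derivative
            intro: has_field_derivative_at_within)
  finally show ?thesis using \<phi>(5) by simp
qed

text \<open>The distribution function of \<open>\<nu>\<close> satisfies \<open>\<nu> {0<..x} = \<integral> 1{y \<le> x} d\<nu>(y)\<close>, so its pairing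
  with \<open>\<phi>'\<close> becomes, after exchanging the integrals, the pairing of \<open>\<nu>\<close> with
  \<open>\<integral> 1{y \<le> x} \<phi>'(x) dx = - \<phi>(y)\<close>.\<close>

lemma has_deriv_measure_cdf:
  assumes \<nu>: "finite_signed_measure Bor01 \<nu>"
  shows "has_deriv_measure (\<lambda>x. c + \<nu> {0<..x}) \<nu>"
proof -
  define T where "T = total_var Bor01 \<nu>"
  have sets_T[measurable_cong]: "sets T = sets Bor01" by (simp add: T_def)
  have space_T: "space T = {0<..<1}" by (simp add: T_def space_Bor01)
  obtain \<sigma> where \<sigma>: "finite_measure T"
    "\<sigma> \<in> borel_measurable Bor01" "\<And>x. \<bar>\<sigma> x\<bar> = 1"
    "\<And>A. A \<in> sets Bor01 \<Longrightarrow> \<nu> A = (LINT x:A|T. \<sigma> x)"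
    "\<And>g. g \<in> borel_measurable Bor01 \<Longrightarrow> signed_integral Bor01 \<nu> g = (LINT x|T. g x * \<sigma> x)"
    by (rule signed_integral_sign[OF \<nu>, folded T_def]) (rule that)
  interpret T: finite_measure T by fact
  interpret L: finite_measure Bor01 by (rule finite_measure_Bor01)
  interpret P: pair_sigma_finite Bor01 T ..
  interpret PF: finite_measure "Bor01 \<Otimes>\<^sub>M T"
    by (rule finite_measure_pair_measure) unfold_locales
  note [measurable] = \<sigma>(2)
  have id_m[measurable]: "(\<lambda>x. x) \<in> borel_measurable Bor01"
    by (intro borel_measurable_Bor01_continuous continuous_intros)
  have id_T[measurable]: "(\<lambda>x. x) \<in> borel_measurable T"
    using id_m by (simp cong: measurable_cong_sets add: sets_T)
  have \<sigma>_T[measurable]: "\<sigma> \<in> borel_measurable T"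
    using \<sigma>(2) by (simp cong: measurable_cong_sets add: sets_T)
  have fst_m: "(\<lambda>p. fst p) \<in> borel_measurable (Bor01 \<Otimes>\<^sub>M T)"
    using measurable_compose[OF measurable_fst id_m] by simp
  have snd_m: "(\<lambda>p. snd p) \<in> borel_measurable (Bor01 \<Otimes>\<^sub>M T)"
    using measurable_compose[OF measurable_snd id_T] by simp
  have \<sigma>snd_m: "(\<lambda>p. \<sigma> (snd p)) \<in> borel_measurable (Bor01 \<Otimes>\<^sub>M T)"
    using measurable_compose[OF measurable_snd \<sigma>_T] by simp
  have kern_m[measurable]: "(\<lambda>p. if snd p \<le> fst p then \<sigma> (snd p) else 0) \<in> borel_measurable (Bor01 \<Otimes>\<^sub>M T)"
    using fst_m snd_m \<sigma>snd_m by measurable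
  define G where "G x = (LINT y|T. (if y \<le> x then \<sigma> y else 0))" for x
  have G: "\<nu> {0<..x} = G x" if "x \<in> {0<..<1}" for x
  proof -
    have "\<nu> {0<..x} = (LINT y:{0<..x}|T. \<sigma> y)"
      using that by (intro \<sigma>(4) sets_Bor01_I) auto
    also have "\<dots> = G x"
      unfolding G_def set_lebesgue_integral_def
      by (intro Bochner_Integration.integral_cong) (auto simp: space_T indicator_def)
    finally show ?thesis .
  qed
  have G_m[measurable]: "G \<in> borel_measurable Bor01"
    unfolding G_def using T.borel_measurable_lebesgue_integral[of "\<lambda>x y. if y \<le> x then \<sigma> y else 0" Bor01]
      kern_m by (simp add: case_prod_beta')
  have u_m: "(\<lambda>x. c + \<nu> {0<..x}) \<in> borel_measurable Bor01"
  proof -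
    have "(\<lambda>x. c + G x) \<in> borel_measurable Bor01" by measurable
    then show ?thesis
      by (subst measurable_cong[of _ _ "\<lambda>x. c + G x"]) (auto simp: space_Bor01 G)
  qed
  have G_int: "integrable Bor01 G"
  proof (rule L.integrable_const_bound[OF _ G_m])
    have "\<bar>G x\<bar> \<le> measure T (space T)" if "x \<in> {0<..<1}" for x
      using abs_finite_signed_measure_le[OF \<nu>, of "{0<..x}"] that
      by (simp add: G[symmetric] T_def sets_Bor01_I subset_eq)
    then show "AE x in Bor01. norm (G x) \<le> measure T (space T)"
      by (intro AE_I2) (auto simp: space_Bor01)
  qed
  have u_int: "integrable Leb01 (\<lambda>x. c + \<nu> {0<..x})"
  proof -
    have "integrable Bor01 (\<lambda>x. c + G x)" using G_int by simp
    then have "integrable Bor01 (\<lambda>x. c + \<nu> {0<..x})"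
      by (subst Bochner_Integration.integrable_cong[of _ _ _ "\<lambda>x. c + G x"])
        (auto simp: space_Bor01 G)
    then show ?thesis using integrable_Leb01_iff_Bor01[OF u_m] by simp
  qed
  have "(LINT x|Leb01. (c + \<nu> {0<..x}) * \<phi>' x) = - signed_integral Bor01 \<nu> \<phi>"
    if \<phi>: "test_function \<phi> \<phi>'" for \<phi> \<phi>'
  proof -
    have \<phi>m[measurable]: "\<phi> \<in> borel_measurable Bor01" "\<phi>' \<in> borel_measurable Bor01"
      using test_functionD[OF \<phi>] by (auto intro: borel_measurable_Bor01_continuous)
    obtain B where B: "\<And>x. x \<in> {0..1} \<Longrightarrow> \<bar>\<phi>' x\<bar> \<le> B"
      using test_function_bounded[OF \<phi>] by blast
    have \<phi>'_int: "integrable Bor01 \<phi>'"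
      by (rule L.integrable_const_bound[of _ B]) (auto simp: space_Bor01 intro!: AE_I2 B)
    have G\<phi>_int: "integrable Bor01 (\<lambda>x. G x * \<phi>' x)"
    proof (rule Bochner_Integration.integrable_bound)
      show "integrable Bor01 (\<lambda>x. B * G x)" using G_int by simp
      show "AE x in Bor01. norm (G x * \<phi>' x) \<le> norm (B * G x)"
      proof (rule AE_I2)
        fix x assume "x \<in> space Bor01"
        then have "\<bar>\<phi>' x\<bar> \<le> B" by (auto simp: space_Bor01 intro: B)
        then have "\<bar>\<phi>' x\<bar> \<le> \<bar>B\<bar>" by simp
        then show "norm (G x * \<phi>' x) \<le> norm (B * G x)"
          by (simp add: abs_mult mult.commute[of "\<bar>B\<bar>"] mult_left_mono)
      qed
    qed measurable
    define F where "F x y = (if y \<le> x then \<sigma> y else 0) * \<phi>' x" for x y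
    have F_int: "integrable (Bor01 \<Otimes>\<^sub>M T) (case_prod F)"
    proof (rule PF.integrable_const_bound[of _ B])
      show "AE p in Bor01 \<Otimes>\<^sub>M T. norm (case_prod F p) \<le> B"
      proof (rule AE_I2)
        fix p assume "p \<in> space (Bor01 \<Otimes>\<^sub>M T)"
        then have "fst p \<in> {0..1}" by (auto simp: space_pair_measure space_Bor01)
        then have "\<bar>\<phi>' (fst p)\<bar> \<le> B" by (rule B)
        then show "norm (case_prod F p) \<le> B"
          by (auto simp: F_def case_prod_beta' abs_mult \<sigma>(3))
      qed
      have "(\<lambda>p. \<phi>' (fst p)) \<in> borel_measurable (Bor01 \<Otimes>\<^sub>M T)"
        using measurable_compose[OF measurable_fst \<phi>m(2)] by simp
      then show "case_prod F \<in> borel_measurable (Bor01 \<Otimes>\<^sub>M T)"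
        unfolding F_def case_prod_beta' using kern_m by measurable
    qed
    have "(LINT x|Leb01. (c + \<nu> {0<..x}) * \<phi>' x) = (LINT x|Bor01. (c + \<nu> {0<..x}) * \<phi>' x)"
      by (rule integral_Leb01_eq_Bor01) (use u_m in measurable)
    also have "\<dots> = (LINT x|Bor01. c * \<phi>' x + G x * \<phi>' x)"
      by (intro Bochner_Integration.integral_cong) (auto simp: space_Bor01 G algebra_simps)
    also have "\<dots> = c * (LINT x|Bor01. \<phi>' x) + (LINT x|Bor01. G x * \<phi>' x)"
      using \<phi>'_int G\<phi>_int by simp
    also have "(LINT x|Bor01. \<phi>' x) = (LINT x|Bor01. (if 0 \<le> x then \<phi>' x else 0))"
      by (intro Bochner_Integration.integral_cong) (auto simp: space_Bor01)
    also have "\<dots> = 0"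
      using integral_test_function_tail[OF \<phi>, of 0] test_functionD(4)[OF \<phi>] by simp
    also have "(LINT x|Bor01. G x * \<phi>' x) = (LINT x|Bor01. LINT y|T. F x y)"
      unfolding F_def G_def by simp
    also have "\<dots> = (LINT y|T. LINT x|Bor01. F x y)"
      using P.Fubini_integral[OF F_int] by simp
    also have "\<dots> = (LINT y|T. - (\<phi> y * \<sigma> y))"
    proof (rule Bochner_Integration.integral_cong[OF refl])
      fix y assume "y \<in> space T"
      then have y: "0 \<le> y" "y \<le> 1" by (auto simp: space_T)
      have "(LINT x|Bor01. F x y) = (LINT x|Bor01. \<sigma> y * (if y \<le> x then \<phi>' x else 0))"
        unfolding F_def by (intro Bochner_Integration.integral_cong) auto
      also have "\<dots> = \<sigma> y * - \<phi> y"
        by (subst integral_mult_right_zero) (simp add: integral_test_function_tail[OF \<phi> y])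
      finally show "(LINT x|Bor01. F x y) = - (\<phi> y * \<sigma> y)" by simp
    qed
    also have "\<dots> = - signed_integral Bor01 \<nu> \<phi>"
      by (simp add: \<sigma>(5)[OF \<phi>m(1)])
    finally show ?thesis by simp
  qed
  then show ?thesis
    using u_int \<nu> by (auto simp: has_deriv_measure_def)
qed

lemma finite_signed_measure_density:
  fixes g :: "real \<Rightarrow> real"
  assumes g: "integrable Leb01 g"
  shows "finite_signed_measure Bor01 (\<lambda>A. LINT x:A|Leb01. g x)"
  unfolding finite_signed_measure_def
proof (intro allI impI)
  fix A :: "nat \<Rightarrow> real set" assume A: "range A \<subseteq> sets Bor01" "disjoint_family A"
  have Am: "A i \<in> sets Leb01" for i
    using A(1) by (intro sets_Bor01_imp_Leb01) blast
  have si: "set_integrable Leb01 B g" if "B \<in> sets Leb01" for B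
    unfolding set_integrable_def using that g by (rule integrable_mult_indicator)
  have U: "(\<Union>i. A i) \<in> sets Leb01" using Am by blast
  have lim: "(\<lambda>n. LINT x:(\<Union>i<n. A i)|Leb01. g x) \<longlonglongrightarrow> (LINT x:(\<Union>n. \<Union>i<n. A i)|Leb01. g x)"
  proof (rule set_integral_cont_up)
    show "\<And>n. (\<Union>i<n. A i) \<in> sets Leb01" using Am by blast
    show "incseq (\<lambda>n. \<Union>i<n. A i)" by (rule incseq_SucI) (auto simp: lessThan_Suc)
    show "set_integrable Leb01 (\<Union>n. \<Union>i<n. A i) g" using Am by (intro si) blast
  qed
  have "(\<Union>n. \<Union>i<n. A i) = (\<Union>i. A i)" by blast
  moreover have "(LINT x:(\<Union>i<n. A i)|Leb01. g x) = (\<Sum>i<n. LINT x:A i|Leb01. g x)" for n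
    by (rule set_integral_finite_Union)
      (use A(2) Am si in \<open>auto simp: disjoint_family_on_def\<close>)
  ultimately show "(\<lambda>i. LINT x:A i|Leb01. g x) sums (LINT x:(\<Union>i. A i)|Leb01. g x)"
    using lim by (simp add: sums_def)
qed

lemma set_integral_abs_le:
  fixes g :: "real \<Rightarrow> real"
  assumes g: "integrable Leb01 g" and A: "A \<in> sets Bor01"
  shows "\<bar>LINT x:A|Leb01. g x\<bar> \<le> (LINT x|Leb01. \<bar>g x\<bar>)"
proof -
  have "\<bar>LINT x:A|Leb01. g x\<bar> \<le> (LINT x|Leb01. \<bar>indicator A x *\<^sub>R g x\<bar>)"
    unfolding set_lebesgue_integral_def by (rule integral_abs_bound)
  also have "\<dots> \<le> (LINT x|Leb01. \<bar>g x\<bar>)"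
  proof (rule integral_mono)
    have "A \<in> sets Leb01" using A by (rule sets_Bor01_imp_Leb01)
    then show "integrable Leb01 (\<lambda>x. \<bar>indicat_real A x *\<^sub>R g x\<bar>)"
      using g by (intro integrable_abs integrable_mult_indicator)
  qed (use g in \<open>auto simp: indicator_def\<close>)
  finally show ?thesis .
qed

section \<open>Functions whose distributional derivative vanishes\<close>

lemma borel_measurable_Leb01_continuous:
  fixes g :: "real \<Rightarrow> real"
  shows "continuous_on UNIV g \<Longrightarrow> g \<in> borel_measurable Leb01"
  by (rule continuous_imp_measurable_on_sets_lebesgue) (auto intro: continuous_on_subset)

lemma integrable_mult_bounded:
  fixes g w :: "'a \<Rightarrow> real"
  assumes "integrable M w" "g \<in> borel_measurable M" "\<And>x. x \<in> space M \<Longrightarrow> \<bar>g x\<bar> \<le> B"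
  shows "integrable M (\<lambda>x. w x * g x)"
proof (rule Bochner_Integration.integrable_bound)
  show "integrable M (\<lambda>x. B * w x)" using assms(1) by simp
  show "(\<lambda>x. w x * g x) \<in> borel_measurable M"
    using assms(2) borel_measurable_integrable[OF assms(1)] by measurable
  show "AE x in M. norm (w x * g x) \<le> norm (B * w x)"
  proof (rule AE_I2)
    fix x assume "x \<in> space M"
    then have "\<bar>g x\<bar> \<le> \<bar>B\<bar>" using assms(3)[of x] by simp
    then show "norm (w x * g x) \<le> norm (B * w x)"
      by (simp add: abs_mult mult.commute[of "\<bar>B\<bar>"] mult_left_mono)
  qed
qed

lemma integral_Leb01_derivative:
  assumes F: "\<And>x. (F has_real_derivative g x) (at x)" and g: "continuous_on UNIV g"
  shows "(LINT x|Leb01. g x) = F 1 - F 0"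
proof -
  have [measurable]: "g \<in> borel_measurable borel"
    by (rule borel_measurable_continuous_onI[OF g])
  have "(LINT x|Leb01. g x) = (LINT x|lborel. indicator {0<..<1} x *\<^sub>R g x)"
    by (subst integral_Leb01_eq_Bor01[OF borel_measurable_Bor01_continuous[OF g]])
      (rule integral_restrict_space, simp)
  also have "\<dots> = (LINT x|lborel. indicator {0..1} x *\<^sub>R g x)"
  proof (rule integral_cong_AE)
    show "AE x in lborel. indicator {0<..<1} x *\<^sub>R g x = indicator {0..1} x *\<^sub>R g x"
      using AE_lborel_singleton[of 0] AE_lborel_singleton[of 1]
      by eventually_elim (auto simp: indicator_def)
  qed measurable
  also have "\<dots> = F 1 - F 0"
    using F continuous_on_subset[OF g]
    by (intro integral_FTC_atLeastAtMost)
      (auto simp flip: has_real_derivative_iff_has_vector_derivative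
            intro: has_field_derivative_at_within)
  finally show ?thesis .
qed

lemma continuous_antiderivative:
  fixes g :: "real \<Rightarrow> real"
  assumes "continuous_on UNIV g"
  obtains F where "\<And>x. (F has_real_derivative g x) (at x)"
proof -
  have "\<exists>F. \<forall>x::real. -\<infinity> < ereal x \<longrightarrow> ereal x < \<infinity> \<longrightarrow> (F has_vector_derivative g x) (at x)"
    by (rule einterval_antiderivative) (use assms in \<open>auto simp: continuous_on_eq_continuous_at\<close>)
  then show thesis using that by (auto simp: has_real_derivative_iff_has_vector_derivative)
qed

text \<open>The support is enclosed in an explicit interval because an antiderivative is constant beyond
  the ends of such an interval.\<close>

definition supported_inside :: "(real \<Rightarrow> real) \<Rightarrow> real \<Rightarrow> real \<Rightarrow> bool" where
  "supported_inside g \<alpha> \<beta> \<longleftrightarrow>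
     continuous_on UNIV g \<and> 0 < \<alpha> \<and> \<alpha> < \<beta> \<and> \<beta> < 1 \<and> (\<forall>x. x \<notin> {\<alpha>..\<beta>} \<longrightarrow> g x = 0)"

lemma test_function_antiderivative:
  assumes g: "supported_inside g \<alpha> \<beta>" and mean: "(LINT x|Leb01. g x) = 0"
  shows "\<exists>\<phi>. test_function \<phi> g"
proof -
  have cont: "continuous_on UNIV g" and \<alpha>: "0 < \<alpha>" "\<alpha> < \<beta>" "\<beta> < 1"
    and out: "\<And>x. x \<notin> {\<alpha>..\<beta>} \<Longrightarrow> g x = 0"
    using g by (auto simp: supported_inside_def)
  obtain F where F: "\<And>x. (F has_real_derivative g x) (at x)"
    using continuous_antiderivative[OF cont] by blast
  have Fc: "continuous_on A F" for A
    using F by (meson DERIV_isCont continuous_at_imp_continuous_on)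
  have left: "F \<alpha> = F x" if "x < \<alpha>" for x
    using that
    by (rule DERIV_isconst_end[OF _ Fc]) (metis F out atLeastAtMost_iff not_le)
  have right: "F x = F \<beta>" if "\<beta> < x" for x
    using that
    by (rule DERIV_isconst_end[OF _ Fc]) (metis F out atLeastAtMost_iff not_le)
  have "F 1 = F 0" using integral_Leb01_derivative[OF F cont] mean by simp
  then have "F \<beta> = F \<alpha>" using left[of 0] right[of 1] \<alpha> by simp
  then have "F x - F \<alpha> = 0" if "x \<notin> {\<alpha>..\<beta>}" for x
    using that left[of x] right[of x] by (cases "x < \<alpha>") auto
  moreover have "((\<lambda>x. F x - F \<alpha>) has_real_derivative g x) (at x)" for x
    using DERIV_diff[OF F[of x] DERIV_const[of "F \<alpha>"]] by simp
  ultimately have "test_function (\<lambda>x. F x - F \<alpha>) g"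
    unfolding test_function_def using cont \<alpha> by (intro conjI allI exI[of _ "{\<alpha>..\<beta>}"]) auto
  then show ?thesis by blast
qed

lemma unit_mass_bump: "\<exists>g \<alpha> \<beta>. supported_inside g \<alpha> \<beta> \<and> (LINT x|Leb01. g x) = 1"
proof -
  (* a tent on [1/4, 3/4], at least 1/8 on [3/8, 5/8] *)
  define g :: "real \<Rightarrow> real" where "g x = max 0 (1/4 - \<bar>x - 1/2\<bar>)" for x
  have cont: "continuous_on UNIV g" unfolding g_def by (intro continuous_intros)
  obtain F where F: "\<And>x. (F has_real_derivative g x) (at x)"
    using continuous_antiderivative[OF cont] by blast
  have mono: "F x \<le> F y" if "x \<le> y" for x y
    by (rule DERIV_nonneg_imp_nondecreasing[OF that]) (metis F g_def max.cobounded1)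
  have "F (3/8) < F (5/8)"
  proof (rule DERIV_pos_imp_increasing[where f = F])
    fix x :: real assume "3/8 \<le> x" "x \<le> 5/8"
    then have "0 < g x" by (auto simp: g_def abs_if)
    then show "\<exists>y. (F has_real_derivative y) (at x) \<and> 0 < y" using F by blast
  qed simp
  then have pos: "0 < (LINT x|Leb01. g x)"
    using integral_Leb01_derivative[OF F cont] mono[of 0 "3/8"] mono[of "5/8" 1] by simp
  define J where "J = (LINT x|Leb01. g x)"
  have "continuous_on UNIV (\<lambda>x. g x / J)"
    using cont pos by (intro continuous_intros) (auto simp: J_def)
  moreover have "g x / J = 0" if "x \<notin> {1/4..3/4}" for x
  proof -
    have "1/4 - \<bar>x - 1/2\<bar> \<le> 0" using that by (auto simp: abs_if field_simps)
    then show ?thesis by (simp add: g_def)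
  qed
  ultimately have "supported_inside (\<lambda>x. g x / J) (1/4) (3/4)"
    by (simp add: supported_inside_def)
  moreover have "(LINT x|Leb01. g x / J) = 1"
    using pos by (simp add: J_def)
  ultimately show ?thesis by blast
qed

text \<open>The powers of a continuous function which equals one exactly on \<open>K\<close> and has compact support
  in \<open>(0,1)\<close> decrease to the indicator function of \<open>K\<close>.\<close>

lemma set_integral_compact_eq_0:
  assumes g: "integrable Leb01 g"
    and test: "\<And>\<eta> \<alpha> \<beta>. supported_inside \<eta> \<alpha> \<beta> \<Longrightarrow> (LINT x|Leb01. g x * \<eta> x) = 0"
    and K: "compact K" "K \<subseteq> {0<..<1}"
  shows "(LINT x:K|Leb01. g x) = (0::real)"
proof (cases "K = {}")
  case True
  then show ?thesis by (simp add: set_lebesgue_integral_def)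
next
  case False
  have "closed (- {0<..<1::real})" "K \<inter> - {0<..<1} = {}"
    using K(2) by (auto intro: closed_Compl)
  then obtain d where d0: "0 < d" "\<forall>x\<in>K. \<forall>y\<in>- {0<..<1}. d \<le> dist x y"
    using separate_compact_closed[OF K(1)] by blast
  have d: "0 < d" "\<And>x y. x \<in> K \<Longrightarrow> y \<notin> {0<..<1} \<Longrightarrow> d \<le> dist x y"
    using d0 by (auto simp del: greaterThanLessThan_iff)
  (* the slope 2/d makes the cutoff vanish at distance d/2 from K, half way to the end points *)
  define \<rho> where "\<rho> x = max 0 (1 - 2 / d * infdist x K)" for x
  have \<rho>: "0 \<le> \<rho> x" "\<rho> x \<le> 1" for x
    using d(1) infdist_nonneg[of x K] by (auto simp: \<rho>_def)
  have \<rho>1: "\<rho> x = 1" if "x \<in> K" for x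
    using that by (simp add: \<rho>_def)
  have \<rho>_less: "\<rho> x < 1" if "x \<notin> K" for x
    using infdist_pos_not_in_closed[of K x] K(1) False that d(1)
    by (auto simp: \<rho>_def compact_imp_closed)
  have \<rho>_cont: "continuous_on UNIV \<rho>"
    unfolding \<rho>_def by (intro continuous_intros)
  have supp: "\<rho> x = 0" if x: "x \<notin> {d/2..1 - d/2}" for x
  proof (rule ccontr)
    assume "\<rho> x \<noteq> 0"
    then have "\<not> 1 - 2 / d * infdist x K \<le> 0" unfolding \<rho>_def by (metis max.absorb1)
    then have lt: "infdist x K < d / 2" using d(1) by (simp add: field_simps)
    obtain k where k: "k \<in> K" "infdist x K = dist x k"
      using infdist_attains_inf[of K x] K(1) False by (auto simp: compact_imp_closed)
    have "d \<le> dist k 0" "d \<le> dist k 1" by (rule d(2)[OF k(1)], simp)+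
    moreover have "k \<in> {0<..<1}" using k(1) K(2) by blast
    ultimately show False
      using lt k(2) x by (auto simp: dist_real_def abs_if split: if_splits)
  qed
  obtain k where "k \<in> K" using False by blast
  then have "k \<in> {0<..<1}" "d \<le> dist k 0" "d \<le> dist k 1"
    using K(2) d(2)[of k 0] d(2)[of k 1] by auto
  then have "d / 2 < 1 - d / 2" using d(1) by (auto simp: dist_real_def)
  moreover have "continuous_on UNIV (\<lambda>x. \<rho> x ^ Suc n)" for n
    by (intro continuous_intros \<rho>_cont)
  ultimately have "supported_inside (\<lambda>x. \<rho> x ^ Suc n) (d/2) (1 - d/2)" for n
    unfolding supported_inside_def using d(1) supp by simp
  then have zero: "(LINT x|Leb01. g x * \<rho> x ^ Suc n) = 0" for n
    by (rule test)
  have "(\<lambda>n. LINT x|Leb01. g x * \<rho> x ^ Suc n) \<longlonglongrightarrow> (LINT x|Leb01. indicator K x *\<^sub>R g x)"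
  proof (rule integral_dominated_convergence)
    have [measurable]: "g \<in> borel_measurable Leb01" "\<rho> \<in> borel_measurable Leb01"
      using g borel_measurable_Leb01_continuous[OF \<rho>_cont] by auto
    have [measurable]: "K \<in> sets Leb01"
      using K by (intro sets_Bor01_imp_Leb01 sets_Bor01_I) (auto simp: compact_imp_closed)
    show "(\<lambda>x. indicator K x *\<^sub>R g x) \<in> borel_measurable Leb01"
      "(\<lambda>x. g x * \<rho> x ^ Suc n) \<in> borel_measurable Leb01" for n
      by measurable
    show "integrable Leb01 (\<lambda>x. \<bar>g x\<bar>)" using g by simp
    show "AE x in Leb01. norm (g x * \<rho> x ^ Suc n) \<le> \<bar>g x\<bar>" for n
    proof (rule AE_I2)
      fix x
      have "\<bar>\<rho> x ^ Suc n\<bar> \<le> 1" using \<rho>[of x] power_le_one[of "\<rho> x" "Suc n"] by simp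
      then show "norm (g x * \<rho> x ^ Suc n) \<le> \<bar>g x\<bar>"
        using mult_left_mono[of "\<bar>\<rho> x ^ Suc n\<bar>" 1 "\<bar>g x\<bar>"] by (simp add: abs_mult)
    qed
    show "AE x in Leb01. (\<lambda>n. g x * \<rho> x ^ Suc n) \<longlonglongrightarrow> indicator K x *\<^sub>R g x"
    proof (rule AE_I2)
      fix x
      show "(\<lambda>n. g x * \<rho> x ^ Suc n) \<longlonglongrightarrow> indicator K x *\<^sub>R g x"
      proof (cases "x \<in> K")
        case True then show ?thesis by (simp add: \<rho>1)
      next
        case False
        have "(\<lambda>n. \<rho> x ^ Suc n) \<longlonglongrightarrow> 0"
          using \<rho>(1)[of x] \<rho>_less[OF False] by (intro LIMSEQ_Suc LIMSEQ_power_zero) simp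
        from tendsto_mult_left[OF this, of "g x"] show ?thesis using False by simp
      qed
    qed
  qed
  then show ?thesis
    by (simp only: zero set_lebesgue_integral_def) (simp add: LIMSEQ_const_iff)
qed

text \<open>By inner regularity the set where \<open>g > 0\<close> is, up to small measure, a compact set; there the
  integral of \<open>g\<close> vanishes although \<open>g\<close> is positive, so this compact set is null.\<close>

lemma AE_nonpos_if_compact_integrals_0:
  fixes g :: "real \<Rightarrow> real"
  assumes g: "integrable Leb01 g"
    and K0: "\<And>K. compact K \<Longrightarrow> K \<subseteq> {0<..<1} \<Longrightarrow> (LINT x:K|Leb01. g x) = 0"
  shows "AE x in Leb01. g x \<le> 0"
proof -
  have [measurable]: "g \<in> borel_measurable Leb01" using g by simp
  define E where "E = {x\<in>space Leb01. 0 < g x}"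
  have E: "E \<in> sets Leb01" unfolding E_def by measurable
  then have EL: "E \<in> sets lebesgue" and E01: "E \<subseteq> {0<..<1}"
    by (auto simp: sets_restrict_space_iff E_def)
  have small: "emeasure lebesgue E \<le> ennreal e" if e: "0 < e" for e
  proof -
    obtain K where K: "closed K" "K \<subseteq> E" "E - K \<in> lmeasurable" "emeasure lebesgue (E - K) < ennreal e"
      using sets_lebesgue_inner_closed[OF EL e] by blast
    have "bounded K" by (rule bounded_subset[of "{0<..<1}"]) (use K(2) E01 in auto)
    then have Kc: "compact K" "K \<subseteq> {0<..<1}"
      using K E01 by (auto simp: compact_eq_bounded_closed)
    have Ks: "K \<in> sets Leb01"
      using Kc by (intro sets_Bor01_imp_Leb01 sets_Bor01_I) (auto simp: compact_imp_closed)
    have "K \<in> null_sets Leb01"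
    proof (rule null_if_pos_func_has_zero_int[OF g Ks])
      show "AE x\<in>K in Leb01. 0 < g x" using K(2) by (auto simp: E_def)
      show "(LINT x:K|Leb01. g x) = 0" by (rule K0[OF Kc])
    qed
    then have "emeasure lebesgue K = 0"
      using Kc by (auto simp: null_sets_def emeasure_restrict_space)
    moreover have "emeasure lebesgue E \<le> emeasure lebesgue K + emeasure lebesgue (E - K)"
    proof -
      have "emeasure lebesgue (K \<union> (E - K)) \<le> emeasure lebesgue K + emeasure lebesgue (E - K)"
        by (rule emeasure_subadditive) (use K EL Kc in auto)
      then show ?thesis using K(2) by (simp add: Un_absorb1)
    qed
    ultimately show ?thesis using K(4) by simp
  qed
  have "emeasure lebesgue E \<le> 0"
    by (rule ennreal_le_epsilon) (simp add: small)
  then have "E \<in> null_sets Leb01"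
    using E E01 by (auto simp: null_sets_def emeasure_restrict_space)
  then have "AE x in Leb01. x \<notin> E" by (rule AE_not_in)
  then show ?thesis
    using AE_space by eventually_elim (simp add: E_def not_less)
qed

text \<open>Subtracting from a test density \<open>\<eta>\<close> the multiple of a fixed unit bump with the same mass gives
  a density of mean zero, hence the derivative of a test function. So \<open>w - c\<close> annihilates
  every \<open>\<eta>\<close>, where \<open>c\<close> is the pairing of \<open>w\<close> with the bump.\<close>

lemma du_Bois_Reymond:
  assumes w: "integrable Leb01 w"
    and zero: "\<And>\<phi> \<phi>'. test_function \<phi> \<phi>' \<Longrightarrow> (LINT x|Leb01. w x * \<phi>' x) = 0"
  shows "\<exists>c. AE x in Leb01. w x = (c::real)"
proof -
  obtain b \<alpha>0 \<beta>0 where b: "supported_inside b \<alpha>0 \<beta>0" and b1: "(LINT x|Leb01. b x) = 1"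
    using unit_mass_bump by blast
  define c where "c = (LINT x|Leb01. w x * b x)"
  have supp_int: "integrable Leb01 \<eta>" "integrable Leb01 (\<lambda>x. v x * \<eta> x)"
    if "supported_inside \<eta> \<alpha> \<beta>" and v: "integrable Leb01 v" for v \<eta> :: "real \<Rightarrow> real" and \<alpha> \<beta>
  proof -
    have c: "continuous_on UNIV \<eta>" using that by (simp add: supported_inside_def)
    have "compact (\<eta> ` {0..1})"
      by (intro compact_continuous_image continuous_on_subset[OF c]) auto
    from compact_imp_bounded[OF this] obtain B where "\<forall>x\<in>{0..1}. \<bar>\<eta> x\<bar> \<le> B"
      by (auto simp: bounded_iff)
    then have B: "\<And>x. x \<in> {0..1} \<Longrightarrow> \<bar>\<eta> x\<bar> \<le> B" by blast
    have "integrable Leb01 (\<lambda>x. u x * \<eta> x)" if "integrable Leb01 u" for u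
      by (rule integrable_mult_bounded[OF that borel_measurable_Leb01_continuous[OF c], of B])
        (auto intro: B)
    from this[OF v] this[of "\<lambda>x. 1"]
    show "integrable Leb01 \<eta>" "integrable Leb01 (\<lambda>x. v x * \<eta> x)"
      by (auto simp: integrable_restrict_space)
  qed
  have test: "(LINT x|Leb01. (w x - c) * \<eta> x) = 0" if \<eta>: "supported_inside \<eta> \<alpha> \<beta>" for \<eta> \<alpha> \<beta>
  proof -
    define m where "m = (LINT x|Leb01. \<eta> x)"
    have "supported_inside (\<lambda>x. \<eta> x - m * b x) (min \<alpha> \<alpha>0) (max \<beta> \<beta>0)"
      unfolding supported_inside_def
    proof (intro conjI allI impI)
      show "continuous_on UNIV (\<lambda>x. \<eta> x - m * b x)"
        using \<eta> b by (auto intro!: continuous_intros simp: supported_inside_def)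
      fix x assume "x \<notin> {min \<alpha> \<alpha>0..max \<beta> \<beta>0}"
      then have "x \<notin> {\<alpha>..\<beta>}" "x \<notin> {\<alpha>0..\<beta>0}" by auto
      then have "\<eta> x = 0" "b x = 0" using \<eta> b by (auto simp: supported_inside_def)
      then show "\<eta> x - m * b x = 0" by simp
    qed (use \<eta> b in \<open>auto simp: supported_inside_def\<close>)
    moreover have "(LINT x|Leb01. \<eta> x - m * b x) = 0"
      using supp_int(1)[OF \<eta> w] supp_int(1)[OF b w] b1 by (simp add: m_def)
    ultimately obtain \<phi> where "test_function \<phi> (\<lambda>x. \<eta> x - m * b x)"
      using test_function_antiderivative by blast
    then have "0 = (LINT x|Leb01. w x * (\<eta> x - m * b x))"
      by (simp add: zero)
    also have "\<dots> = (LINT x|Leb01. w x * \<eta> x - m * (w x * b x))"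
      by (intro Bochner_Integration.integral_cong) (auto simp: algebra_simps)
    also have "\<dots> = (LINT x|Leb01. w x * \<eta> x) - m * c"
      using supp_int(2)[OF \<eta> w] supp_int(2)[OF b w] by (simp add: c_def)
    also have "\<dots> = (LINT x|Leb01. (w x - c) * \<eta> x)"
      using supp_int[OF \<eta> w] by (simp add: m_def left_diff_distrib)
    finally show ?thesis by simp
  qed
  have gi: "integrable Leb01 (\<lambda>x. w x - c)" "integrable Leb01 (\<lambda>x. - (w x - c))"
    using w by (auto simp: integrable_restrict_space)
  have K0: "(LINT x:K|Leb01. w x - c) = 0" if "compact K" "K \<subseteq> {0<..<1}" for K
    using set_integral_compact_eq_0[OF gi(1) test that] .
  have "AE x in Leb01. w x - c \<le> 0"
    by (rule AE_nonpos_if_compact_integrals_0[OF gi(1) K0])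
  moreover have "AE x in Leb01. - (w x - c) \<le> 0"
  proof (rule AE_nonpos_if_compact_integrals_0[OF gi(2)])
    fix K :: "real set" assume "compact K" "K \<subseteq> {0<..<1}"
    then show "(LINT x:K|Leb01. - (w x - c)) = 0"
      using K0[of K] by (simp add: set_lebesgue_integral_def del: minus_diff_eq)
  qed
  ultimately have "AE x in Leb01. w x = c" by eventually_elim simp
  then show ?thesis ..
qed

lemma has_deriv_measure_unique:
  assumes u: "has_deriv_measure u \<nu>" and v: "has_deriv_measure v \<nu>"
  shows "\<exists>c. AE x in Leb01. u x = c + v x"
proof -
  have int: "integrable Leb01 u" "integrable Leb01 v"
    using u v by (auto simp: has_deriv_measure_def)
  have "\<exists>c. AE x in Leb01. u x - v x = c"
  proof (rule du_Bois_Reymond)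
    show "integrable Leb01 (\<lambda>x. u x - v x)" using int by simp
    fix \<phi> \<phi>' assume \<phi>: "test_function \<phi> \<phi>'"
    obtain B where B: "\<And>x. x \<in> {0..1} \<Longrightarrow> \<bar>\<phi>' x\<bar> \<le> B"
      using test_function_bounded[OF \<phi>] by blast
    have "integrable Leb01 (\<lambda>x. w x * \<phi>' x)" if "integrable Leb01 w" for w
      by (rule integrable_mult_bounded[OF that borel_measurable_Leb01_continuous[OF test_functionD(2)[OF \<phi>]], of B])
        (auto intro: B)
    then show "(LINT x|Leb01. (u x - v x) * \<phi>' x) = 0"
      using int u v \<phi> by (simp add: left_diff_distrib has_deriv_measure_def)
  qed
  then obtain c where "AE x in Leb01. u x - v x = c" ..
  then have "AE x in Leb01. u x = c + v x" by eventually_elim simp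
  then show ?thesis ..
qed

section \<open>The nonlinearity\<close>

text \<open>The bound \<open>f(s) \<le> K\<close> makes the flux of a solution small with \<open>\<lambda>\<close>. The bound \<open>f(s) \<le> K s\<close>, which
  near zero rests on \<open>p \<ge> 1\<close>, makes the variation of a small solution small relative to
  its size.\<close>

lemma nonlinearity_bound:
  fixes f :: "real \<Rightarrow> real" and h p q :: real
  assumes cont: "continuous_on UNIV f" and f0: "f 0 = 0"
    and h: "0 < h" and p: "1 \<le> p" and q: "0 < q"
    and lim0: "((\<lambda>u. f u / u powr p) \<longlongrightarrow> 1) (at_right 0)"
    and lim_top: "((\<lambda>u. f u / u powr (- q)) \<longlongrightarrow> h) at_top"
  shows "\<exists>K>0. \<forall>s\<ge>0. f s \<le> K \<and> f s \<le> K * s"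
proof -
  have "eventually (\<lambda>u. f u / u powr p < 2) (at_right 0)"
    by (rule order_tendstoD(2)[OF lim0]) simp
  then obtain b0 where b0: "0 < b0" "\<And>u. 0 < u \<Longrightarrow> u < b0 \<Longrightarrow> f u / u powr p < 2"
    by (auto simp: eventually_at_right_field)
  define b where "b = min b0 1"
  have b: "0 < b" using b0 by (simp add: b_def)
  have near: "f u \<le> 2 * u \<and> f u \<le> 2" if u: "0 < u" "u < b" for u
  proof -
    have "f u \<le> 2 * u powr p" using b0(2)[of u] u by (simp add: b_def field_simps)
    also have "u powr p \<le> u powr 1"
      using u p by (intro powr_mono') (auto simp: b_def)
    finally have "f u \<le> 2 * u" using u by simp
    moreover have "u \<le> 1" using u by (simp add: b_def)
    ultimately show ?thesis by linarith
  qed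
  have "eventually (\<lambda>u. f u / u powr (- q) < h + 1) at_top"
    by (rule order_tendstoD(2)[OF lim_top]) simp
  then obtain N0 where N0: "\<And>u. N0 \<le> u \<Longrightarrow> f u / u powr (- q) < h + 1"
    by (auto simp: eventually_at_top_linorder)
  define N where "N = max N0 1"
  have far: "f u \<le> (h + 1) * u \<and> f u \<le> h + 1" if u: "N \<le> u" for u
  proof -
    have u1: "1 \<le> u" using u by (simp add: N_def)
    have "f u / u powr (- q) < h + 1" using N0[of u] u by (simp add: N_def)
    then have "f u < (h + 1) * u powr (- q)" using u1 by (simp add: divide_less_eq)
    also have "\<dots> \<le> (h + 1) * 1"
    proof (rule mult_left_mono)
      have "u powr (- q) \<le> u powr 0" using u1 q by (intro powr_mono) auto
      then show "u powr (- q) \<le> 1" using u1 by simp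
    qed (use h in simp)
    finally have 1: "f u \<le> h + 1" by simp
    moreover have "h + 1 \<le> (h + 1) * u" using u1 h by simp
    ultimately show ?thesis by linarith
  qed
  have "compact (f ` {b..N})"
    by (intro compact_continuous_image continuous_on_subset[OF cont]) auto
  from compact_imp_bounded[OF this] obtain B where B: "\<forall>u\<in>{b..N}. \<bar>f u\<bar> \<le> B"
    by (auto simp: bounded_iff)
  define K where "K = h + 3 + \<bar>B\<bar> + \<bar>B\<bar> / b"
  have Bb: "0 \<le> \<bar>B\<bar> / b" using b by simp
  have K: "0 < K" "2 \<le> K" "h + 1 \<le> K" "\<bar>B\<bar> \<le> K" "\<bar>B\<bar> / b \<le> K"
    using h Bb unfolding K_def by linarith+
  have "f s \<le> K \<and> f s \<le> K * s" if s: "0 \<le> s" for s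
  proof -
    consider "s = 0" | "0 < s" "s < b" | "b \<le> s" "s \<le> N" | "N \<le> s" using s by linarith
    then show ?thesis
    proof cases
      case 1 then show ?thesis using f0 K(1) by simp
    next
      case 2
      then show ?thesis
        using near[of s] K mult_right_mono[OF K(2), of s] by linarith
    next
      case 3
      then have "\<bar>f s\<bar> \<le> B" using B by simp
      then have f: "f s \<le> \<bar>B\<bar>" by linarith
      have "\<bar>B\<bar> * 1 \<le> \<bar>B\<bar> * (s / b)" using 3 b by (intro mult_left_mono) auto
      also have "\<dots> \<le> K * s" using mult_right_mono[OF K(5), of s] s by simp
      finally show ?thesis using f K by linarith
    next
      case 4
      then show ?thesis
        using far[of s] K mult_right_mono[OF K(3), of s] s by linarith
    qed
  qed
  then show ?thesis using K(1) by blast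
qed

lemma ratio_tendsto_1_if_power_like:
  fixes f :: "real \<Rightarrow> real" and c s :: "nat \<Rightarrow> real"
  assumes c: "\<And>n. 0 < c n" and s: "\<And>n. 0 < s n" and sc: "(\<lambda>n. s n / c n) \<longlonglongrightarrow> 1"
    and lim: "((\<lambda>u. f u / u powr e) \<longlongrightarrow> L) F" and L: "L \<noteq> 0"
    and F: "filterlim c F sequentially" "filterlim s F sequentially"
  shows "(\<lambda>n. f (s n) / f (c n)) \<longlonglongrightarrow> 1"
proof -
  have "(\<lambda>n. f (s n) / s n powr e) \<longlonglongrightarrow> L" "(\<lambda>n. f (c n) / c n powr e) \<longlonglongrightarrow> L"
    using F by (auto intro: filterlim_compose[OF lim])
  moreover have "(\<lambda>n. (s n / c n) powr e) \<longlonglongrightarrow> 1 powr e"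
    by (intro tendsto_powr sc tendsto_const) simp
  ultimately have "(\<lambda>n. (f (s n) / s n powr e) / (f (c n) / c n powr e) * (s n / c n) powr e)
      \<longlonglongrightarrow> L / L * 1 powr e"
    using L by (intro tendsto_mult tendsto_divide)
  moreover have "(f (s n) / s n powr e) / (f (c n) / c n powr e) * (s n / c n) powr e = f (s n) / f (c n)" for n
    using c[of n] s[of n] by (simp add: powr_divide field_simps)
  ultimately show ?thesis using L by simp
qed

text \<open>A relative change of the argument by at most \<open>\<epsilon>\<close> changes \<open>f\<close> by a factor close to one,
  uniformly on the whole half-line: near zero and near infinity because \<open>f\<close> is
  asymptotic to a power, in between by continuity. A sequence of counterexamples has a limit point
  in \<open>[0, \<infinity>]\<close>, and the three cases \<open>0\<close>, \<open>\<infinity>\<close> and in between contradict these facts.\<close>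

lemma nonlinearity_slowly_varying:
  fixes f :: "real \<Rightarrow> real" and h p q :: real
  assumes cont: "continuous_on UNIV f" and pos: "\<And>u. 0 < u \<Longrightarrow> 0 < f u" and h: "0 < h"
    and lim0: "((\<lambda>u. f u / u powr p) \<longlongrightarrow> 1) (at_right 0)"
    and lim_top: "((\<lambda>u. f u / u powr (- q)) \<longlongrightarrow> h) at_top"
    and \<eta>: "0 < \<eta>"
  shows "\<exists>\<epsilon>>0. \<forall>c>0. \<forall>s. \<bar>s - c\<bar> \<le> \<epsilon> * c \<longrightarrow> \<bar>f s - f c\<bar> \<le> \<eta> * f c"
proof (rule ccontr)
  assume neg: "\<not> ?thesis"
  have "\<exists>c s. 0 < c \<and> \<bar>s - c\<bar> \<le> inverse (real (n + 2)) * c \<and> \<not> \<bar>f s - f c\<bar> \<le> \<eta> * f c" for n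
  proof -
    have "0 < inverse (real (n + 2))" by simp
    then show ?thesis using neg by blast
  qed
  then obtain c s where cs: "\<And>n. 0 < c n" "\<And>n. \<bar>s n - c n\<bar> \<le> inverse (real (n + 2)) * c n"
    "\<And>n. \<not> \<bar>f (s n) - f (c n)\<bar> \<le> \<eta> * f (c n)" by metis
  have half: "c n / 2 \<le> s n" for n
  proof -
    have "inverse (real (n + 2)) \<le> 1/2" by (simp add: field_simps)
    then have "inverse (real (n + 2)) * c n \<le> 1/2 * c n"
      using cs(1)[of n] by (intro mult_right_mono) auto
    then show ?thesis using cs(2)[of n] by linarith
  qed
  have s: "0 < s n" for n using half[of n] cs(1)[of n] by linarith
  have sc: "(\<lambda>n. s n / c n) \<longlonglongrightarrow> 1"
  proof (rule LIM_zero_cancel, rule Lim_null_comparison)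
    show "eventually (\<lambda>n. norm (s n / c n - 1) \<le> inverse (real (n + 2))) sequentially"
    proof (rule always_eventually, rule allI)
      fix n
      have "s n / c n - 1 = (s n - c n) / c n" using cs(1)[of n] by (simp add: field_simps)
      then show "norm (s n / c n - 1) \<le> inverse (real (n + 2))"
        using cs(2)[of n] cs(1)[of n] by (simp add: pos_divide_le_eq)
    qed
  qed (rule LIMSEQ_ignore_initial_segment[OF lim_inverse_n])
  obtain l r where r: "strict_mono r" and l: "((\<lambda>n. ereal (c n)) \<circ> r) \<longlonglongrightarrow> l"
    using compact_complete_linorder[of "\<lambda>n. ereal (c n)"] by blast
  define C S where "C n = c (r n)" and "S n = s (r n)" for n
  have l: "(\<lambda>n. ereal (C n)) \<longlonglongrightarrow> l" using l by (simp add: C_def comp_def)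
  have CS: "0 < C n" "0 < S n" "C n / 2 \<le> S n" for n
    using cs(1) s half by (auto simp: C_def S_def)
  have SC: "(\<lambda>n. S n / C n) \<longlonglongrightarrow> 1"
    using LIMSEQ_subseq_LIMSEQ[OF sc r] by (simp add: comp_def C_def S_def)
  have S_eq: "S n = C n * (S n / C n)" for n using CS(1)[of n] by simp
  have "0 \<le> l"
    using CS(1) by (intro LIMSEQ_le_const[OF l]) (auto intro!: exI[of _ 0] less_imp_le)
  have "(\<lambda>n. f (S n) / f (C n)) \<longlonglongrightarrow> 1"
  proof (cases l)
    case (real l0)
    then have Cl: "C \<longlonglongrightarrow> l0" using l by simp
    have Sl: "S \<longlonglongrightarrow> l0"
      using tendsto_mult[OF Cl SC] by (subst S_eq[abs_def]) simp
    show ?thesis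
    proof (cases "l0 = 0")
      case True
      have "C n \<noteq> 0" "S n \<noteq> 0" for n using CS(1,2)[of n] by auto
      then have "filterlim C (at_right 0) sequentially" "filterlim S (at_right 0) sequentially"
        using Cl Sl CS True by (auto simp: filterlim_at intro!: always_eventually)
      then show ?thesis
        by (intro ratio_tendsto_1_if_power_like[OF CS(1,2) SC lim0]) simp_all
    next
      case False
      then have l0: "0 < l0" using \<open>0 \<le> l\<close> real by simp
      have "isCont f l0" using cont by (simp add: continuous_on_eq_continuous_at)
      then have "(\<lambda>n. f (S n)) \<longlonglongrightarrow> f l0" "(\<lambda>n. f (C n)) \<longlonglongrightarrow> f l0"
        using Sl Cl by (auto intro: isCont_tendsto_compose)
      from tendsto_divide[OF this] show ?thesis using pos[OF l0] by simp
    qed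
  next
    case PInf
    then have C_top: "filterlim C at_top sequentially"
      using l by (simp add: tendsto_PInfty_eq_at_top)
    have S_top: "filterlim S at_top sequentially"
    proof (rule filterlim_at_top_mono)
      show "filterlim (\<lambda>n. 1/2 * C n) at_top sequentially"
        by (rule filterlim_tendsto_pos_mult_at_top[OF tendsto_const _ C_top]) simp
    qed (use CS(3) in simp)
    show ?thesis
      by (rule ratio_tendsto_1_if_power_like[OF CS(1,2) SC lim_top _ C_top S_top]) (use h in simp)
  next
    case MInf
    then show ?thesis using \<open>0 \<le> l\<close> by simp
  qed
  then have "eventually (\<lambda>n. dist (f (S n) / f (C n)) 1 < \<eta>) sequentially"
    using \<eta> by (rule tendstoD)
  then obtain n where n: "\<bar>f (S n) / f (C n) - 1\<bar> < \<eta>"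
    by (auto simp: eventually_sequentially dist_real_def)
  have fC: "0 < f (C n)" by (rule pos[OF CS(1)])
  have "f (S n) - f (C n) = (f (S n) / f (C n) - 1) * f (C n)"
    using fC by (simp add: field_simps)
  then have "\<bar>f (S n) - f (C n)\<bar> \<le> \<eta> * f (C n)"
    using n fC by (simp add: abs_mult)
  then show False using cs(3)[of "r n"] by (simp add: C_def S_def)
qed

section \<open>Testing the equation with distribution functions\<close>

text \<open>A distribution function \<open>k + (\<psi> dx + us)(0,x]\<close> is an admissible test function for every integrable
  \<open>\<psi>\<close>, as its singular part is that of the solution. Testing with it turns the singular term of the
  equation into the total variation of \<open>us\<close>, and \<open>u\<close> itself is of this form with \<open>\<psi> = ua\<close>.\<close>

lemma BV_solution_tested:
  assumes "BV_solution a f lam u"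
  obtains c ua us where "integrable Leb01 ua" "finite_signed_measure Bor01 us"
    "AE x in Leb01. u x = c + ((LINT y:{0<..x}|Leb01. ua y) + us {0<..x})"
    "\<And>\<psi> k. integrable Leb01 \<psi> \<Longrightarrow>
       (LINT x|Leb01. ua x * \<psi> x / sqrt (1 + (ua x)\<^sup>2)) + measure (total_var Bor01 us) (space Bor01)
       = (LINT x|Leb01. lam * a x * f (u x) * (k + ((LINT y:{0<..x}|Leb01. \<psi> y) + us {0<..x})))"
proof -
  obtain ua us \<nu> where u: "has_deriv_measure u \<nu>" and dec: "lebesgue_decomposition \<nu> ua us"
    and sol: "\<And>\<phi> \<phi>a \<phi>s. has_BV_derivative \<phi> \<phi>a \<phi>s \<Longrightarrow>
          absolutely_continuous (total_var Bor01 us) (total_var Bor01 \<phi>s) \<Longrightarrow>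
          (LINT x|Leb01. ua x * \<phi>a x / sqrt (1 + (ua x)\<^sup>2)) + signed_integral Bor01 \<phi>s (polar Bor01 us)
          = (LINT x|Leb01. lam * a x * f (u x) * \<phi> x)"
    using assms unfolding BV_solution_def has_BV_derivative_def by blast
  have ua: "integrable Leb01 ua" and us: "finite_signed_measure Bor01 us"
    and sing: "\<exists>N\<in>null_sets Bor01. emeasure (total_var Bor01 us) ({0<..<1} - N) = 0"
    and \<nu>_eq: "\<And>A. A \<in> sets Bor01 \<Longrightarrow> \<nu> A = (LINT x:A|Leb01. ua x) + us A"
    using dec unfolding lebesgue_decomposition_def by simp_all
  have \<nu>: "finite_signed_measure Bor01 \<nu>"
    using u by (simp add: has_deriv_measure_def)
  obtain c where c: "AE x in Leb01. u x = c + (0 + \<nu> {0<..x})"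
    using has_deriv_measure_unique[OF u has_deriv_measure_cdf[OF \<nu>, of 0]] by blast
  have rep: "AE x in Leb01. u x = c + ((LINT y:{0<..x}|Leb01. ua y) + us {0<..x})"
    using c AE_space
  proof eventually_elim
    case (elim x)
    then have "{0<..x} \<in> sets Bor01" by (intro sets_Bor01_I) auto
    then show ?case using elim(1) by (simp add: \<nu>_eq)
  qed
  have "(LINT x|Leb01. ua x * \<psi> x / sqrt (1 + (ua x)\<^sup>2)) + measure (total_var Bor01 us) (space Bor01)
       = (LINT x|Leb01. lam * a x * f (u x) * (k + ((LINT y:{0<..x}|Leb01. \<psi> y) + us {0<..x})))"
    if \<psi>: "integrable Leb01 \<psi>" for \<psi> k
  proof -
    let ?\<mu> = "\<lambda>A. (LINT x:A|Leb01. \<psi> x) + us A"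
    have \<mu>: "finite_signed_measure Bor01 ?\<mu>"
      by (rule finite_signed_measure_add[OF finite_signed_measure_density[OF \<psi>] us])
    have bv: "has_BV_derivative (\<lambda>x. k + ?\<mu> {0<..x}) \<psi> us"
      unfolding has_BV_derivative_def
    proof (intro exI conjI)
      show "has_deriv_measure (\<lambda>x. k + ?\<mu> {0<..x}) ?\<mu>" by (rule has_deriv_measure_cdf[OF \<mu>])
      show "lebesgue_decomposition ?\<mu> \<psi> us"
        unfolding lebesgue_decomposition_def using \<psi> us sing by simp
    qed
    have "absolutely_continuous (total_var Bor01 us) (total_var Bor01 us)"
      by (simp add: absolutely_continuous_def)
    from sol[OF bv this] show ?thesis
      by (simp only: signed_integral_polar_self[OF us])
  qed
  then show thesis by (rule that[OF ua us rep])
qed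

text \<open>If \<open>g\<close> is not integrable, its integral is zero by convention, and the bound holds because
  \<open>d\<close> is nonnegative almost everywhere.\<close>

lemma abs_integral_le_AE:
  fixes g d :: "'a \<Rightarrow> real"
  assumes d: "integrable M d" and le: "AE x in M. \<bar>g x\<bar> \<le> d x"
  shows "\<bar>LINT x|M. g x\<bar> \<le> (LINT x|M. d x)"
proof (cases "integrable M g")
  case True
  have "\<bar>LINT x|M. g x\<bar> \<le> (LINT x|M. \<bar>g x\<bar>)" by (rule integral_abs_bound)
  also have "\<dots> \<le> (LINT x|M. d x)" using True d le by (intro integral_mono_AE) auto
  finally show ?thesis .
next
  case False
  have "0 \<le> (LINT x|M. d x)"
    using le by (intro integral_nonneg_AE) (auto elim!: AE_mp)
  then show ?thesis using False by (simp add: not_integrable_integral_eq)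
qed

lemma abs_cdf_le:
  fixes \<psi> :: "real \<Rightarrow> real"
  assumes \<psi>: "integrable Leb01 \<psi>" and \<mu>: "finite_signed_measure Bor01 \<mu>" and x: "x \<in> {0<..<1}"
  shows "\<bar>(LINT y:{0<..x}|Leb01. \<psi> y) + \<mu> {0<..x}\<bar>
    \<le> (LINT y|Leb01. \<bar>\<psi> y\<bar>) + measure (total_var Bor01 \<mu>) (space Bor01)"
proof -
  have "{0<..x} \<in> sets Bor01" using x by (intro sets_Bor01_I) auto
  from set_integral_abs_le[OF \<psi> this] abs_finite_signed_measure_le[OF \<mu> this]
  show ?thesis by linarith
qed

lemma positive_essD:
  assumes "positive_ess u" and u: "u \<in> borel_measurable Leb01"
  shows "AE x in Leb01. 0 \<le> u x" "\<And>b. AE x in Leb01. u x \<le> b \<Longrightarrow> 0 < b"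
proof -
  have inf: "essinf Leb01 (\<lambda>x. ereal (u x)) \<ge> 0" and sup: "esssup Leb01 (\<lambda>x. ereal (u x)) > 0"
    using assms(1) by (auto simp: positive_ess_def)
  from inf have neg: "esssup Leb01 (\<lambda>x. - ereal (u x)) \<le> 0"
    unfolding essinf_def by (simp add: ereal_0_le_uminus_iff)
  have "AE x in Leb01. - ereal (u x) \<le> esssup Leb01 (\<lambda>x. - ereal (u x))"
    by (rule esssup_AE)
  then show "AE x in Leb01. 0 \<le> u x"
  proof eventually_elim
    case (elim x)
    then have "- ereal (u x) \<le> 0" using neg by (rule order_trans)
    then show ?case by simp
  qed
  fix b assume b: "AE x in Leb01. u x \<le> b"
  have "esssup Leb01 (\<lambda>x. ereal (u x)) \<le> ereal b"
  proof (rule esssup_I)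
    show "(\<lambda>x. ereal (u x)) \<in> borel_measurable Leb01"
      using u by (rule borel_measurable_ereal)
    show "AE x in Leb01. ereal (u x) \<le> ereal b" using b by simp
  qed
  with sup have "0 < ereal b" by (rule less_le_trans)
  then show "0 < b" by simp
qed

lemma half_le_flux:
  fixes v :: real
  shows "1 < \<bar>v\<bar> \<Longrightarrow> 1/2 \<le> \<bar>v\<bar> / sqrt (1 + v\<^sup>2)"
    and "\<bar>v\<bar> \<le> 1 \<Longrightarrow> \<bar>v\<bar> / 2 \<le> \<bar>v\<bar> / sqrt (1 + v\<^sup>2)"
proof -
  have pos: "0 < sqrt (1 + v\<^sup>2)" by (simp add: add_pos_nonneg)
  show "1/2 \<le> \<bar>v\<bar> / sqrt (1 + v\<^sup>2)" if "1 < \<bar>v\<bar>"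
  proof -
    have "1\<^sup>2 \<le> \<bar>v\<bar>\<^sup>2" using that by (intro power_mono) auto
    then have "sqrt (1 + v\<^sup>2) \<le> sqrt ((2 * \<bar>v\<bar>)\<^sup>2)"
      by (intro real_sqrt_le_mono) (simp add: power_mult_distrib)
    also have "\<dots> = 2 * \<bar>v\<bar>" by (simp only: real_sqrt_abs)
    finally show ?thesis using pos by (simp add: field_simps)
  qed
  show "\<bar>v\<bar> / 2 \<le> \<bar>v\<bar> / sqrt (1 + v\<^sup>2)" if "\<bar>v\<bar> \<le> 1"
  proof -
    have "\<bar>v\<bar>\<^sup>2 \<le> 1\<^sup>2" using that by (intro power_mono) auto
    then have "sqrt (1 + v\<^sup>2) \<le> sqrt (2\<^sup>2)"
      by (intro real_sqrt_le_mono) simp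
    also have "\<dots> = 2" by simp
    finally show ?thesis using pos by (intro divide_left_mono) auto
  qed
qed

section \<open>Solutions for small \<open>\<lambda>\<close> are nearly constant\<close>

text \<open>The equation bounds the flux by \<open>\<lambda> A K\<close>, where \<open>A\<close> is the \<open>L\<^sup>1\<close> norm of \<open>a\<close>. On the singular part
  of the derivative the flux has modulus one, and where \<open>|ua| > 1\<close> it has modulus at least
  one half, so for \<open>\<lambda> A K < 1/4\<close> neither can occur. Quantitatively, the distribution function of
  \<open>sgn(ua) 1{|ua| > 1} dx + us\<close> is bounded by its own total variation \<open>V\<close>, and testing with it gives
  \<open>V/2 \<le> \<lambda> A K V\<close>. Once \<open>|ua| \<le> 1\<close> the flux is at least \<open>|ua|/2\<close>, and testing with \<open>sgn(ua)\<close> as derivative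
  bounds the variation \<open>\<delta>\<close> of \<open>u\<close>. The estimate keeps \<open>S\<close> arbitrary because it is to be used with a
  bound for \<open>f(u)\<close> that depends on \<open>\<delta>\<close> itself.\<close>

lemma BV_solution_nearly_constant:
  fixes a f u :: "real \<Rightarrow> real"
  defines "A \<equiv> LINT x|Leb01. \<bar>a x\<bar>"
  assumes a: "integrable Leb01 a" and sol: "BV_solution a f lam u" and lam: "0 < lam"
    and f_nn: "AE x in Leb01. 0 \<le> f (u x)" and fK: "AE x in Leb01. f (u x) \<le> K"
    and small: "lam * A * K < 1/4"
  shows "(LINT x|Leb01. lam * (a x * f (u x))) = 0"
    and "\<exists>c \<delta>. (AE x in Leb01. \<bar>u x - c\<bar> \<le> \<delta>) \<and>
      (\<forall>S\<ge>0. (AE x in Leb01. f (u x) \<le> S) \<longrightarrow> \<delta> \<le> 2 * lam * A * S)"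
proof -
  obtain c ua us where ua: "integrable Leb01 ua"
    and us: "finite_signed_measure Bor01 us"
    and rep: "AE x in Leb01. u x = c + ((LINT y:{0<..x}|Leb01. ua y) + us {0<..x})"
    and tested: "\<And>\<psi> k. integrable Leb01 \<psi> \<Longrightarrow>
       (LINT x|Leb01. ua x * \<psi> x / sqrt (1 + (ua x)\<^sup>2)) + measure (total_var Bor01 us) (space Bor01)
       = (LINT x|Leb01. lam * a x * f (u x) * (k + ((LINT y:{0<..x}|Leb01. \<psi> y) + us {0<..x})))"
    by (rule BV_solution_tested[OF sol]) (rule that)
  define T where "T = measure (total_var Bor01 us) (space Bor01)"
  have T: "0 \<le> T" by (simp add: T_def)
  have [measurable]: "ua \<in> borel_measurable Leb01" using ua by simp
  have estimate: "(LINT x|Leb01. ua x * \<psi> x / sqrt (1 + (ua x)\<^sup>2)) + T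
      \<le> lam * A * S * ((LINT x|Leb01. \<bar>\<psi> x\<bar>) + T)"
    if \<psi>: "integrable Leb01 \<psi>" and S: "AE x in Leb01. f (u x) \<le> S" for \<psi> S
  proof -
    let ?P = "(LINT x|Leb01. \<bar>\<psi> x\<bar>) + T"
    let ?g = "\<lambda>x. lam * a x * f (u x) * (0 + ((LINT y:{0<..x}|Leb01. \<psi> y) + us {0<..x}))"
    have "\<bar>LINT x|Leb01. ?g x\<bar> \<le> (LINT x|Leb01. lam * S * ?P * \<bar>a x\<bar>)"
    proof (rule abs_integral_le_AE)
      show "integrable Leb01 (\<lambda>x. lam * S * ?P * \<bar>a x\<bar>)" using a by simp
      show "AE x in Leb01. \<bar>?g x\<bar> \<le> lam * S * ?P * \<bar>a x\<bar>"
        using S f_nn AE_space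
      proof eventually_elim
        case (elim x)
        then have \<Phi>: "\<bar>(LINT y:{0<..x}|Leb01. \<psi> y) + us {0<..x}\<bar> \<le> ?P"
          unfolding T_def by (intro abs_cdf_le[OF \<psi> us]) simp
        have "f (u x) * \<bar>(LINT y:{0<..x}|Leb01. \<psi> y) + us {0<..x}\<bar> \<le> S * ?P"
          using elim \<Phi> by (intro mult_mono) auto
        then have "(lam * \<bar>a x\<bar>) * (f (u x) * \<bar>(LINT y:{0<..x}|Leb01. \<psi> y) + us {0<..x}\<bar>)
            \<le> (lam * \<bar>a x\<bar>) * (S * ?P)"
          using lam by (intro mult_left_mono) auto
        then show ?case
          using elim lam by (simp add: abs_mult ac_simps)
      qed
    qed
    also have "\<dots> = lam * A * S * ?P" by (simp add: A_def ac_simps)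
    finally show ?thesis
      using tested[OF \<psi>, of 0] unfolding T_def by linarith
  qed
  (* test the equation with the steep part of the derivative *)
  define \<psi> where "\<psi> x = (if 1 < \<bar>ua x\<bar> then sgn (ua x) else 0)" for x
  have unit_int: "integrable Leb01 g" if "g \<in> borel_measurable Leb01" "\<And>x. \<bar>g x\<bar> \<le> 1" for g :: "real \<Rightarrow> real"
    using integrable_mult_bounded[of Leb01 "\<lambda>_. 1" g 1] that by (simp add: integrable_restrict_space)
  have \<psi>m[measurable]: "\<psi> \<in> borel_measurable Leb01" unfolding \<psi>_def by measurable
  have \<psi>: "integrable Leb01 \<psi>" by (rule unit_int) (auto simp: \<psi>_def sgn_if)
  have flux_int: "integrable Leb01 (\<lambda>x. ua x * g x / sqrt (1 + (ua x)\<^sup>2))"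
    if [measurable]: "g \<in> borel_measurable Leb01" and g: "\<And>x. \<bar>g x\<bar> \<le> 1" for g
  proof (rule unit_int)
    fix x
    have "\<bar>ua x\<bar> \<le> sqrt (1 + (ua x)\<^sup>2)" by (rule real_le_rsqrt) simp
    then have "\<bar>ua x\<bar> * \<bar>g x\<bar> \<le> sqrt (1 + (ua x)\<^sup>2) * 1" using g by (intro mult_mono) auto
    then show "\<bar>ua x * g x / sqrt (1 + (ua x)\<^sup>2)\<bar> \<le> 1"
      by (simp add: abs_mult divide_le_eq add_pos_nonneg)
  qed measurable
  have "(LINT x|Leb01. \<bar>\<psi> x\<bar> / 2) \<le> (LINT x|Leb01. ua x * \<psi> x / sqrt (1 + (ua x)\<^sup>2))"
  proof (rule integral_mono)
    show "integrable Leb01 (\<lambda>x. ua x * \<psi> x / sqrt (1 + (ua x)\<^sup>2))"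
      by (rule flux_int[OF \<psi>m]) (auto simp: \<psi>_def sgn_if)
    show "\<bar>\<psi> x\<bar> / 2 \<le> ua x * \<psi> x / sqrt (1 + (ua x)\<^sup>2)" for x
      using half_le_flux(1)[of "ua x"] by (auto simp: \<psi>_def sgn_if abs_if split: if_splits)
  qed (use \<psi> in simp)
  also have "(LINT x|Leb01. \<bar>\<psi> x\<bar> / 2) = (LINT x|Leb01. \<bar>\<psi> x\<bar>) / 2" by simp
  finally have low: "(LINT x|Leb01. \<bar>\<psi> x\<bar>) / 2 \<le> (LINT x|Leb01. ua x * \<psi> x / sqrt (1 + (ua x)\<^sup>2))" .
  from estimate[OF \<psi> fK] low
  have "(LINT x|Leb01. \<bar>\<psi> x\<bar>) / 2 + T \<le> lam * A * K * ((LINT x|Leb01. \<bar>\<psi> x\<bar>) + T)" by linarith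
  also have "\<dots> \<le> 1/4 * ((LINT x|Leb01. \<bar>\<psi> x\<bar>) + T)"
    using small T by (intro mult_right_mono) auto
  finally have "(LINT x|Leb01. \<bar>\<psi> x\<bar>) / 4 + 3/4 * T \<le> 0" by argo
  moreover have "0 \<le> (LINT x|Leb01. \<bar>\<psi> x\<bar>)" by simp
  ultimately have P0: "(LINT x|Leb01. \<bar>\<psi> x\<bar>) = 0" and T0: "T = 0" using T by linarith+
  have "AE x in Leb01. \<bar>\<psi> x\<bar> = 0"
    using P0 \<psi> by (subst (asm) integral_nonneg_eq_0_iff_AE) auto
  then have ua1: "AE x in Leb01. \<bar>ua x\<bar> \<le> 1"
    by eventually_elim (auto simp: \<psi>_def sgn_if split: if_splits)
  have us0: "us {0<..x} = 0" if "x \<in> {0<..<1}" for x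
  proof -
    have "{0<..x} \<in> sets Bor01" using that by (intro sets_Bor01_I) auto
    from abs_finite_signed_measure_le[OF us this] T0 show ?thesis by (simp add: T_def)
  qed
  show "(LINT x|Leb01. lam * (a x * f (u x))) = 0"
  proof -
    have "(LINT x|Leb01. lam * a x * f (u x) * (1 + ((LINT y:{0<..x}|Leb01. 0) + us {0<..x}))) = 0"
      using tested[of "\<lambda>_. 0" 1] T0 by (simp add: T_def)
    also have "(LINT x|Leb01. lam * a x * f (u x) * (1 + ((LINT y:{0<..x}|Leb01. 0) + us {0<..x})))
        = (LINT x|Leb01. lam * (a x * f (u x)))"
      by (intro Bochner_Integration.integral_cong) (auto simp: us0 set_lebesgue_integral_def)
    finally show ?thesis .
  qed
  define \<delta> where "\<delta> = (LINT x|Leb01. \<bar>ua x\<bar>)"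
  have u_c: "AE x in Leb01. \<bar>u x - c\<bar> \<le> \<delta>"
    using rep AE_space
  proof eventually_elim
    case (elim x)
    then show ?case
      using abs_cdf_le[OF ua us, of x] T0 by (simp add: \<delta>_def T_def)
  qed
  have "\<delta> \<le> 2 * lam * A * S" if S: "0 \<le> S" "AE x in Leb01. f (u x) \<le> S" for S
  proof -
    have sm[measurable]: "(\<lambda>x. sgn (ua x)) \<in> borel_measurable Leb01" by measurable
    have s_int: "integrable Leb01 (\<lambda>x. sgn (ua x))" by (rule unit_int) (auto simp: sgn_if)
    have "\<delta> / 2 = (LINT x|Leb01. \<bar>ua x\<bar> / 2)" by (simp add: \<delta>_def)
    also have "\<dots> \<le> (LINT x|Leb01. ua x * sgn (ua x) / sqrt (1 + (ua x)\<^sup>2))"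
    proof (rule integral_mono_AE)
      show "integrable Leb01 (\<lambda>x. ua x * sgn (ua x) / sqrt (1 + (ua x)\<^sup>2))"
        by (rule flux_int[OF sm]) (auto simp: sgn_if)
      show "AE x in Leb01. \<bar>ua x\<bar> / 2 \<le> ua x * sgn (ua x) / sqrt (1 + (ua x)\<^sup>2)"
        using ua1 by eventually_elim (use half_le_flux(2) in \<open>simp add: abs_sgn\<close>)
    qed (use ua in simp)
    also have "\<dots> \<le> lam * A * S * ((LINT x|Leb01. \<bar>sgn (ua x)\<bar>) + T)"
      using estimate[OF s_int S(2)] T0 by simp
    also have "\<dots> \<le> lam * A * S * 1"
    proof (rule mult_left_mono)
      have "(LINT x|Leb01. \<bar>sgn (ua x)\<bar>) \<le> (LINT x|Leb01. 1)"
        by (rule integral_mono) (use s_int unit_int[of "\<lambda>_. 1"] in \<open>auto simp: sgn_if\<close>)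
      then show "(LINT x|Leb01. \<bar>sgn (ua x)\<bar>) + T \<le> 1"
        using T0 by (simp add: measure_restrict_space)
    qed (use lam S(1) in \<open>simp add: A_def\<close>)
    finally show ?thesis by simp
  qed
  then show "\<exists>c \<delta>. (AE x in Leb01. \<bar>u x - c\<bar> \<le> \<delta>) \<and>
      (\<forall>S\<ge>0. (AE x in Leb01. f (u x) \<le> S) \<longrightarrow> \<delta> \<le> 2 * lam * A * S)"
    using u_c by blast
qed

section \<open>Nonexistence of positive solutions\<close>

theorem theorem2p1:
  fixes a f :: "real \<Rightarrow> real" and h p q :: real
  assumes "integrable Leb01 a"
    and "(LINT x|Leb01. a x) < 0"
    and "emeasure Leb01 {x\<in>{0<..<1}. a x > 0} > 0"
    and "continuous_on UNIV f"
    and "f 0 = 0"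
    and "\<And>u. u > 0 \<Longrightarrow> f u > 0"
    and "h > 0" and "p \<ge> 1" and "0 < q" and "q < 1"
    and "((\<lambda>u. f u / u powr p) \<longlongrightarrow> 1) (at_right 0)"
    and "((\<lambda>u. f u / u powr (- q)) \<longlongrightarrow> h) at_top"
  shows "\<exists>lambda_bar>0. \<forall>lam\<in>{0<..<lambda_bar}. \<not> (\<exists>u. BV_solution a f lam u \<and> positive_ess u)"
proof -
  note a = assms(1) and cont = assms(4) and f_pos = assms(6)
  define A I where "A = (LINT x|Leb01. \<bar>a x\<bar>)" and "I = (LINT x|Leb01. a x)"
  have "\<bar>I\<bar> \<le> A" unfolding A_def I_def by (rule integral_abs_bound)
  then have I: "I < 0" and A: "0 < A" using assms(2) by (auto simp: I_def)
  obtain K where K: "0 < K" "\<And>s. 0 \<le> s \<Longrightarrow> f s \<le> K" "\<And>s. 0 \<le> s \<Longrightarrow> f s \<le> K * s"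
    using nonlinearity_bound[OF assms(4,5,7,8,9,11,12)] by blast
  have f_nn: "0 \<le> f s" if "0 \<le> s" for s
    using that f_pos[of s] assms(5) by (cases "s = 0") (auto intro: less_imp_le)
  (* with this tolerance an error of at most \<eta> f(c) in f(u) moves the integral by at most half of |I| f(c) *)
  define \<eta> where "\<eta> = - I / (2 * A)"
  have \<eta>: "0 < \<eta>" using I A by (simp add: \<eta>_def divide_neg_pos)
  obtain \<epsilon> where \<epsilon>: "0 < \<epsilon>" "\<And>c s. 0 < c \<Longrightarrow> \<bar>s - c\<bar> \<le> \<epsilon> * c \<Longrightarrow> \<bar>f s - f c\<bar> \<le> \<eta> * f c"
    using nonlinearity_slowly_varying[OF cont f_pos assms(7,11,12) \<eta>] by metis
  (* the bound 1/4 excludes steep and singular parts, \<epsilon>/4 makes |u - c| at most \<epsilon> c *)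
  define lbar where "lbar = min (1/4) (\<epsilon>/4) / (K * A)"
  have lbar: "0 < lbar" using \<epsilon>(1) K(1) A by (simp add: lbar_def)
  have "False" if lam: "0 < lam" "lam < lbar" and sol: "BV_solution a f lam u" and up: "positive_ess u"
    for lam u
  proof -
    have "lam * (K * A) < min (1/4) (\<epsilon>/4)"
      using lam(2) K(1) A by (simp add: lbar_def pos_less_divide_eq)
    then have lKA: "lam * A * K < 1/4" "lam * A * K < \<epsilon>/4" by (simp_all add: ac_simps)
    have u: "u \<in> borel_measurable Leb01"
      using sol by (auto simp: BV_solution_def has_BV_derivative_def has_deriv_measure_def)
    have u_nn: "AE x in Leb01. 0 \<le> u x"
      and u_pos: "\<And>b. AE x in Leb01. u x \<le> b \<Longrightarrow> 0 < b"
      using positive_essD[OF up u] by auto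
    have fu_nn: "AE x in Leb01. 0 \<le> f (u x)" using u_nn by eventually_elim (rule f_nn)
    have fu_K: "AE x in Leb01. f (u x) \<le> K" using u_nn by eventually_elim (rule K(2))
    note near = BV_solution_nearly_constant[OF a sol lam(1) fu_nn fu_K, folded A_def, OF lKA(1)]
    obtain c \<delta> where u_c: "AE x in Leb01. \<bar>u x - c\<bar> \<le> \<delta>"
      and \<delta>_S: "\<And>S. 0 \<le> S \<Longrightarrow> AE x in Leb01. f (u x) \<le> S \<Longrightarrow> \<delta> \<le> 2 * lam * A * S"
      using near(2) by blast
    from u_c have "AE x in Leb01. u x \<le> c + \<delta>" by eventually_elim linarith
    then have c\<delta>: "0 < c + \<delta>" by (rule u_pos)
    (* f(u) is bounded in terms of the size of u, so that |u - c| is small relative to c *)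
    have "AE x in Leb01. f (u x) \<le> K * (c + \<delta>)"
      using u_c u_nn
    proof eventually_elim
      case (elim x)
      then have "K * u x \<le> K * (c + \<delta>)" using K(1) by (intro mult_left_mono) auto
      then show ?case using K(3)[of "u x"] elim by linarith
    qed
    from \<delta>_S[OF _ this] have \<delta>_le: "\<delta> \<le> 2 * (lam * A * K) * (c + \<delta>)"
      using K(1) c\<delta> by (simp add: ac_simps)
    have "2 * (lam * A * K) * (c + \<delta>) \<le> 1/2 * (c + \<delta>)"
      using lKA(1) c\<delta> by (intro mult_right_mono) auto
    with \<delta>_le have "\<delta> \<le> c" by argo
    then have c: "0 < c" using c\<delta> by linarith
    have "2 * (lam * A * K) * (c + \<delta>) \<le> \<epsilon>/2 * (2 * c)"
      using lKA(2) c\<delta> \<open>\<delta> \<le> c\<close> \<epsilon>(1) by (intro mult_mono) auto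
    with \<delta>_le have \<delta>\<epsilon>: "\<delta> \<le> \<epsilon> * c" by argo
    have close: "AE x in Leb01. \<bar>f (u x) - f c\<bar> \<le> \<eta> * f c"
      using u_c
    proof eventually_elim
      case (elim x)
      then show ?case using \<delta>\<epsilon> by (intro \<epsilon>(2)[OF c]) linarith
    qed
    have fum[measurable]: "(\<lambda>x. f (u x)) \<in> borel_measurable Leb01"
      using measurable_compose[OF u borel_measurable_continuous_onI[OF cont]] .
    have afu: "integrable Leb01 (\<lambda>x. a x * f (u x))"
    proof (rule Bochner_Integration.integrable_bound)
      show "integrable Leb01 (\<lambda>x. K * a x)" using a by simp
      show "(\<lambda>x. a x * f (u x)) \<in> borel_measurable Leb01"
        using a fum by (intro borel_measurable_times) auto
      show "AE x in Leb01. norm (a x * f (u x)) \<le> norm (K * a x)"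
        using u_nn
      proof eventually_elim
        case (elim x)
        then have "\<bar>f (u x)\<bar> \<le> K" using K(2)[of "u x"] f_nn[of "u x"] by simp
        then have "\<bar>a x\<bar> * \<bar>f (u x)\<bar> \<le> \<bar>a x\<bar> * K" by (rule mult_left_mono) simp
        then show ?case using K(1) by (simp add: abs_mult ac_simps)
      qed
    qed
    have zero: "(LINT x|Leb01. a x * f (u x)) = 0" using near(1) lam(1) by simp
    have "f c * I = (LINT x|Leb01. a x * f c)" by (simp add: I_def)
    also have "\<dots> = (LINT x|Leb01. a x * f c - a x * f (u x))"
      using a afu zero by simp
    finally have "f c * - I = - (LINT x|Leb01. a x * f c - a x * f (u x))" by simp
    also have "\<dots> \<le> \<bar>LINT x|Leb01. a x * f c - a x * f (u x)\<bar>" by linarith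
    also have "\<dots> \<le> (LINT x|Leb01. \<eta> * f c * \<bar>a x\<bar>)"
    proof (rule abs_integral_le_AE)
      show "integrable Leb01 (\<lambda>x. \<eta> * f c * \<bar>a x\<bar>)" using a by simp
      show "AE x in Leb01. \<bar>a x * f c - a x * f (u x)\<bar> \<le> \<eta> * f c * \<bar>a x\<bar>"
        using close
      proof eventually_elim
        case (elim x)
        have "\<bar>a x * f c - a x * f (u x)\<bar> = \<bar>f (u x) - f c\<bar> * \<bar>a x\<bar>"
          by (simp add: abs_mult[symmetric] algebra_simps abs_minus_commute)
        also have "\<dots> \<le> \<eta> * f c * \<bar>a x\<bar>" using elim by (intro mult_right_mono) auto
        finally show ?case .
      qed
    qed
    also have "\<dots> = f c * (- I / 2)" using A by (simp add: A_def[symmetric] \<eta>_def)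
    finally have "f c * (- I / 2) \<le> 0" by (simp add: mult.commute)
    moreover have "0 < f c * (- I / 2)" using f_pos[OF c] I by (intro mult_pos_pos) auto
    ultimately show False by linarith
  qed
  then show ?thesis using lbar by (intro exI[of _ lbar]) auto
qed

end
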